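(* Let $b,\rho>0$ and $\sigma\ge0$ satisfy $\sigma^2<\rho+2b$, and consider the equation $$\rho V=\left(\frac{x^{2}}{x^{2}+1}-bx\right)V_x-\left(\ln(-V_x)+x^{2}+1\right)+\frac{1}{2}\sigma^{2}x^{2}V_{xx}.\qquad (\mathrm{OHJB})$$ Assume that $u\in C([0,\infty))$ is a bounded from above, strictly decreasing viscosity subsolution of (OHJB) in $[0,\infty)$, and that $v\in C([0,\infty))$ is a bounded from above, strictly decreasing viscosity supersolution of (OHJB) in $(0,\infty)$, such that, for some positive constants $c$ and $c^*$, $v(x)\ge -c(1+x^2)$ for all $x\ge 0$ and $Du\le -\frac{1}{c^*}$ in the viscosity sense. Then $u\le v$ in $[0,\infty)$.
   Context: For $x\ge0$, $p,P\in\mathbb R$ put $$H(x,p,P)=\left(\frac{x^{2}}{x^{2}+1}-bx\right)p-\left(\ln(-p)+x^{2}+1\right)+\frac12\sigma^2x^2P\ \text{ if } p<0,\qquad H(x,p,P)=+\infty\ \text{ if } p\ge0,$$ so (OHJB) reads $\rho V=H(x,V_x,V_{xx})$. A continuous function $w$ on $[0,\infty)$ is a viscosity subsolution in $[0,\infty)$ if, for every smooth $\phi$ and every (local) maximum point $x_0\in[0,\infty)$ of $w-\phi$ relative to $[0,\infty)$, $\rho w(x_0)-H(x_0,\phi'(x_0),\phi''(x_0))\le 0$; it is a viscosity supersolution in $(0,\infty)$ if, for every smooth $\phi$ and every (local) minimum point $x_0\in(0,\infty)$ of $w-\phi$, $\rho w(x_0)-H(x_0,\phi'(x_0),\phi''(x_0))\ge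 0$. The condition $Du\le-1/c^*$ in the viscosity sense means: for every smooth $\phi$ and every local maximum point $x_0\in(0,\infty)$ of $u-\phi$, $\phi'(x_0)\le-1/c^*$. *)

theory Defs
  imports "HOL-Analysis.Analysis"
begin

definition smooth_fun :: "(real \<Rightarrow> real) \<Rightarrow> bool" where
  "smooth_fun \<phi> \<longleftrightarrow> (\<forall>n x. (deriv ^^ n) \<phi> field_differentiable (at x))"

definition local_max_on :: "real set \<Rightarrow> (real \<Rightarrow> real) \<Rightarrow> real \<Rightarrow> bool" where
  "local_max_on S f x0 \<longleftrightarrow> x0 \<in> S \<and> (\<forall>\<^sub>F x in at x0 within S. f x \<le> f x0)"

definition local_min_on :: "real set \<Rightarrow> (real \<Rightarrow> real) \<Rightarrow> real \<Rightarrow> bool" where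
  "local_min_on S f x0 \<longleftrightarrow> x0 \<in> S \<and> (\<forall>\<^sub>F x in at x0 within S. f x0 \<le> f x)"

text \<open>The equation is \<open>\<rho> V = H(x, V', V'')\<close>.  With the \<open>ereal\<close> conventions, \<open>\<rho> w - H\<close> equals
  \<open>-\<infinity>\<close> when \<open>p \<ge> 0\<close>, so the subsolution inequality is void there and the supersolution
  inequality fails.\<close>

definition hamiltonian :: "real \<Rightarrow> real \<Rightarrow> real \<Rightarrow> real \<Rightarrow> real \<Rightarrow> ereal" where
  "hamiltonian b \<sigma> x p P =
     (if p < 0
      then ereal ((x\<^sup>2 / (x\<^sup>2 + 1) - b * x) * p - (ln (- p) + x\<^sup>2 + 1) + 1 / 2 * \<sigma>\<^sup>2 * x\<^sup>2 * P)
      else \<infinity>)"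

text \<open>Test functions are smooth on all of \<open>\<real>\<close>; extrema of \<open>w - \<phi>\<close> are local and relative to
  \<open>S\<close>, so an endpoint belonging to \<open>S\<close> is tested from one side only.\<close>

definition viscosity_subsolution_on ::
  "real \<Rightarrow> real \<Rightarrow> real \<Rightarrow> real set \<Rightarrow> (real \<Rightarrow> real) \<Rightarrow> bool" where
  "viscosity_subsolution_on b \<rho> \<sigma> S w \<longleftrightarrow>
     (\<forall>\<phi> x0. smooth_fun \<phi> \<longrightarrow> local_max_on S (\<lambda>x. w x - \<phi> x) x0 \<longrightarrow>
        ereal (\<rho> * w x0) - hamiltonian b \<sigma> x0 (deriv \<phi> x0) (deriv (deriv \<phi>) x0) \<le> 0)"

definition viscosity_supersolution_on ::
  "real \<Rightarrow> real \<Rightarrow> real \<Rightarrow> real set \<Rightarrow> (real \<Rightarrow> real) \<Rightarrow> bool" where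
  "viscosity_supersolution_on b \<rho> \<sigma> S w \<longleftrightarrow>
     (\<forall>\<phi> x0. smooth_fun \<phi> \<longrightarrow> local_min_on S (\<lambda>x. w x - \<phi> x) x0 \<longrightarrow>
        ereal (\<rho> * w x0) - hamiltonian b \<sigma> x0 (deriv \<phi> x0) (deriv (deriv \<phi>) x0) \<ge> 0)"

definition viscosity_deriv_le_on :: "real set \<Rightarrow> (real \<Rightarrow> real) \<Rightarrow> real \<Rightarrow> bool" where
  "viscosity_deriv_le_on S w m \<longleftrightarrow>
     (\<forall>\<phi> x0. smooth_fun \<phi> \<longrightarrow> local_max_on S (\<lambda>x. w x - \<phi> x) x0 \<longrightarrow> deriv \<phi> x0 \<le> m)"

end

theory Submission
  imports Defs
begin

text \<open>
  Compare \<open>u\<close> and \<open>v\<close> at a maximum point \<open>x0\<close> of \<open>u - v - \<epsilon> (1 + x\<^sup>2) ln (1 + x\<^sup>2)\<close>; the penalty beats the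
  quadratic growth of \<open>- v\<close>, and it is a supersolution of the linearized equation, up to a constant,
  because \<open>\<sigma>\<^sup>2 < \<rho> + 2 b\<close>.  The bound \<open>Du \<le> - 1 / c\<^sup>*\<close> makes the logarithm Lipschitz with constant \<open>c\<^sup>*\<close> at
  the slopes of \<open>u\<close>.

  If \<open>x0 > 0\<close> and \<open>\<sigma> = 0\<close>, doubling of variables suffices.  If \<open>x0 > 0\<close> and \<open>\<sigma> > 0\<close>, the equation is
  nondegenerate near \<open>x0\<close> and makes \<open>u\<close> and \<open>- v\<close> semiconvex there.  At a maximum of \<open>u - v\<close> both are
  then differentiable, with nearby slopes close to those at \<open>x0\<close>, so the equation bounds the second
  derivatives of \<open>u\<close> and \<open>- v\<close> below by nearly constant values; in one dimension such viscosity
  bounds are convexity statements, and they can be added.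

  If \<open>x0 = 0\<close>, the subsolution property at \<open>0\<close> limits the steepness of \<open>u\<close>, hence that of \<open>v\<close>, at \<open>0\<close>, and
  testing \<open>v\<close> at interior points with nearly the same slope gives the supersolution inequality at \<open>0\<close>.
\<close>

section \<open>Superjets of functions of one variable\<close>

text \<open>The neighbourhood is two-sided, so this describes interior points. Subjets of
  \<open>v\<close> appear as superjets of \<open>\<lambda>x. - v x\<close>, with both entries
  negated.\<close>

definition superjet :: "(real \<Rightarrow> real) \<Rightarrow> real \<Rightarrow> real \<Rightarrow> real \<Rightarrow> bool" where
  "superjet f x p X \<longleftrightarrow> (\<forall>\<^sub>F y in at x. f y \<le> f x + p * (y - x) + X / 2 * (y - x)\<^sup>2)"

lemma superjetI:
  assumes "d > 0" "\<And>y. \<bar>y - x\<bar> < d \<Longrightarrow> f y \<le> f x + p * (y - x) + X / 2 * (y - x)\<^sup>2"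
  shows "superjet f x p X"
  unfolding superjet_def eventually_at using assms by (auto simp: dist_real_def)

lemma superjetE:
  assumes "superjet f x p X"
  obtains d where "d > 0" "\<And>y. \<bar>y - x\<bar> < d \<Longrightarrow> f y \<le> f x + p * (y - x) + X / 2 * (y - x)\<^sup>2"
proof -
  obtain d where d: "d > 0" "\<And>y. y \<noteq> x \<Longrightarrow> \<bar>y - x\<bar> < d \<Longrightarrow> f y \<le> f x + p * (y - x) + X / 2 * (y - x)\<^sup>2"
    using assms unfolding superjet_def eventually_at by (auto simp: dist_real_def)
  show thesis
  proof (rule that[OF d(1)])
    fix y assume "\<bar>y - x\<bar> < d"
    then show "f y \<le> f x + p * (y - x) + X / 2 * (y - x)\<^sup>2" using d(2) by (cases "y = x") auto
  qed
qed

text \<open>The margin \<kappa> keeps the difference quotient of \<open>\<phi>'\<close> at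
  \<open>x\<close> below \<open>X + \<kappa>\<close>, so \<phi> minus the parabola is nondecreasing
  before \<open>x\<close> and nonincreasing after it.\<close>

lemma superjet_of_C2:
  fixes \<phi> \<phi>' :: "real \<Rightarrow> real"
  assumes d: "d > 0" "\<And>y. \<bar>y - x\<bar> < d \<Longrightarrow> (\<phi> has_real_derivative \<phi>' y) (at y)"
    and D2: "(\<phi>' has_real_derivative X) (at x)" and "\<kappa> > 0"
  shows "superjet \<phi> x (\<phi>' x) (X + \<kappa>)"
proof -
  have "((\<lambda>y. (\<phi>' y - \<phi>' x) / (y - x)) \<longlongrightarrow> X) (at x)"
    using D2 by (simp add: has_field_derivative_iff)
  then have "\<forall>\<^sub>F y in at x. (\<phi>' y - \<phi>' x) / (y - x) < X + \<kappa>"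
    using \<open>\<kappa> > 0\<close> by (intro order_tendstoD) auto
  then obtain e where e: "e > 0"
    "\<And>y. y \<noteq> x \<Longrightarrow> \<bar>y - x\<bar> < e \<Longrightarrow> (\<phi>' y - \<phi>' x) / (y - x) < X + \<kappa>"
    unfolding eventually_at by (auto simp: dist_real_def)
  define h where "h y = \<phi> y - (\<phi> x + \<phi>' x * (y - x) + (X + \<kappa>) / 2 * (y - x)\<^sup>2)" for y
  have h': "(h has_real_derivative \<phi>' y - \<phi>' x - (X + \<kappa>) * (y - x)) (at y)" if "\<bar>y - x\<bar> < d" for y
    unfolding h_def using d(2)[OF that] by (auto intro!: derivative_eq_intros)
  have "h y \<le> h x" if y: "\<bar>y - x\<bar> < min d e" for y
  proof (cases y x rule: linorder_cases)
    case less
    show ?thesis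
    proof (rule DERIV_nonneg_imp_nondecreasing[where f = h])
      fix z assume z: "y \<le> z" "z \<le> x"
      have "\<phi>' z - \<phi>' x - (X + \<kappa>) * (z - x) \<ge> 0"
      proof (cases "z = x")
        case False
        then show ?thesis using e(2)[of z] z y less by (auto simp: field_simps)
      qed auto
      then show "\<exists>y. (h has_real_derivative y) (at z) \<and> 0 \<le> y"
        using h'[of z] z y less by force
    qed (use less in auto)
  next
    case greater
    show ?thesis
    proof (rule DERIV_nonpos_imp_nonincreasing[where f = h])
      fix z assume z: "x \<le> z" "z \<le> y"
      have "\<phi>' z - \<phi>' x - (X + \<kappa>) * (z - x) \<le> 0"
      proof (cases "z = x")
        case False
        then show ?thesis using e(2)[of z] z y greater by (auto simp: field_simps)
      qed auto
      then show "\<exists>y. (h has_real_derivative y) (at z) \<and> y \<le> 0"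
        using h'[of z] z y greater by force
    qed (use greater in auto)
  qed auto
  then show ?thesis
    using d(1) e(1) by (intro superjetI[of "min d e"]) (auto simp: h_def)
qed

section \<open>Convexity from lower bounds on superjets\<close>

text \<open>If the function rose above a chord, a slightly bent chord would touch it from above at
  an interior point and yield a superjet with second-order entry below \<open>k\<close>.\<close>

lemma convex_on_if_superjets_ge:
  fixes f :: "real \<Rightarrow> real"
  assumes cont: "continuous_on {a..b} f"
    and jet: "\<And>x p X. a < x \<Longrightarrow> x < b \<Longrightarrow> superjet f x p X \<Longrightarrow> k \<le> X"
  shows "convex_on {a..b} (\<lambda>x. f x - k / 2 * x\<^sup>2)"
proof (rule convex_on_linorderI)
  fix t x y :: real
  assume t: "t > 0" "t < 1" and xy: "x \<in> {a..b}" "y \<in> {a..b}" "x < y"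
  define F where "F \<tau> = f \<tau> - k / 2 * \<tau>\<^sup>2" for \<tau>
  define z where "z = (1 - t) * x + t * y"
  define s where "s = (F y - F x) / (y - x)"
  define e where "e = F z - F x - s * (z - x)"
  have zx: "z - x = t * (y - x)" "y - z = (1 - t) * (y - x)"
    by (auto simp: z_def algebra_simps)
  have zpos: "z - x > 0" "y - z > 0"
    unfolding zx using t xy by auto
  have sy: "s * (y - x) = F y - F x"
    using xy by (simp add: s_def)
  have "e \<le> 0"
  proof (rule ccontr)
    assume "\<not> e \<le> 0"
    \<comment> \<open>The correction costs half the excess \<open>e\<close> at \<open>z\<close> and
      vanishes at \<open>x\<close> and \<open>y\<close>, so \<open>G\<close> is positive at
      \<open>z\<close>, zero at the ends, and has its maximum inside.\<close>
    define \<kappa> where "\<kappa> = e / (2 * ((z - x) * (y - z)))"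
    have \<kappa>: "\<kappa> > 0" "\<kappa> * ((z - x) * (y - z)) = e / 2"
      unfolding \<kappa>_def using zpos \<open>\<not> e \<le> 0\<close> by (simp_all only: divide_simps) auto
    define G where "G \<tau> = F \<tau> - F x - s * (\<tau> - x) + \<kappa> * ((\<tau> - x) * (\<tau> - y))" for \<tau>
    have "continuous_on {x..y} G"
      unfolding G_def F_def using xy
      by (intro continuous_intros continuous_on_subset[OF cont]) auto
    then obtain m where m: "m \<in> {x..y}" "\<And>\<tau>. \<tau> \<in> {x..y} \<Longrightarrow> G \<tau> \<le> G m"
      using continuous_attains_sup[of "{x..y}" G] xy by auto
    have Gz: "G z = e - \<kappa> * ((z - x) * (y - z))"
      by (simp add: G_def e_def algebra_simps)
    then have "G z > 0" using \<kappa> \<open>\<not> e \<le> 0\<close> by auto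
    moreover have "G x = 0" "G y = 0"
      using sy by (auto simp: G_def)
    ultimately have "m \<noteq> x" "m \<noteq> y"
      using m(2)[of z] zpos by auto
    then have mm: "x < m" "m < y" using m by auto
    have "superjet f m (k * m + s - \<kappa> * (2 * m - x - y)) (k - 2 * \<kappa>)"
    proof (rule superjetI)
      show "min (m - x) (y - m) > 0" using mm by auto
      fix \<tau> assume "\<bar>\<tau> - m\<bar> < min (m - x) (y - m)"
      then have "G \<tau> \<le> G m" by (intro m) auto
      then show "f \<tau> \<le> f m + (k * m + s - \<kappa> * (2 * m - x - y)) * (\<tau> - m) + (k - 2 * \<kappa>) / 2 * (\<tau> - m)\<^sup>2"
        unfolding G_def F_def by (simp add: field_simps power2_eq_square)
    qed
    then show False using jet[of m] mm xy \<kappa> by force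
  qed
  then have "F z \<le> F x + s * (t * (y - x))" unfolding e_def zx by simp
  also have "\<dots> = F x + t * (F y - F x)" unfolding sy[symmetric] by simp
  finally have "F z \<le> (1 - t) * F x + t * F y" by (simp add: algebra_simps)
  then show "f ((1 - t) *\<^sub>R x + t *\<^sub>R y) - k / 2 * ((1 - t) *\<^sub>R x + t *\<^sub>R y)\<^sup>2
      \<le> (1 - t) * (f x - k / 2 * x\<^sup>2) + t * (f y - k / 2 * y\<^sup>2)"
    by (simp add: F_def z_def)
qed auto

text \<open>Dividing the two parabola bounds by \<open>y - x\<close> on either side and letting
  \<open>y\<close> tend to \<open>x\<close> leaves only the slopes: parabolas above and below act as
  differentiability.\<close>

lemma superjet_slope_unique:
  assumes "superjet f x p X" and low: "\<forall>\<^sub>F y in at x. f x + q * (y - x) + k / 2 * (y - x)\<^sup>2 \<le> f y"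
  shows "p = q"
proof -
  have ev: "\<forall>\<^sub>F y in at x. q * (y - x) + k / 2 * (y - x)\<^sup>2 \<le> p * (y - x) + X / 2 * (y - x)\<^sup>2"
    using assms(1)[unfolded superjet_def] low by eventually_elim simp
  have lim: "((\<lambda>y. (X - k) / 2 * (y - x)) \<longlongrightarrow> 0) (at x within S)" for S
    by (auto intro!: tendsto_eq_intros)
  have "\<forall>\<^sub>F y in at_right x. q * (y - x) + k / 2 * (y - x)\<^sup>2 \<le> p * (y - x) + X / 2 * (y - x)\<^sup>2"
    using ev filter_leD[OF at_le[OF subset_UNIV]] by blast
  moreover have "\<forall>\<^sub>F y in at_right x. x < y" by (simp add: eventually_at_filter)
  ultimately have "\<forall>\<^sub>F y in at_right x. q - p \<le> (X - k) / 2 * (y - x)"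
  proof eventually_elim
    case (elim y)
    then have "(q - p) * (y - x) \<le> ((X - k) / 2 * (y - x)) * (y - x)"
      by (simp add: field_simps power2_eq_square)
    then show ?case using elim by simp
  qed
  then have "q - p \<le> 0"
    by (rule tendsto_lowerbound[OF lim]) auto
  have "\<forall>\<^sub>F y in at_left x. q * (y - x) + k / 2 * (y - x)\<^sup>2 \<le> p * (y - x) + X / 2 * (y - x)\<^sup>2"
    using ev filter_leD[OF at_le[OF subset_UNIV]] by blast
  moreover have "\<forall>\<^sub>F y in at_left x. y < x" by (simp add: eventually_at_filter)
  ultimately have "\<forall>\<^sub>F y in at_left x. (X - k) / 2 * (y - x) \<le> q - p"
  proof eventually_elim
    case (elim y)
    then have "((X - k) / 2 * (y - x)) * (x - y) \<le> (q - p) * (x - y)"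
      by (simp add: field_simps power2_eq_square)
    then show ?case using elim by simp
  qed
  then have "0 \<le> q - p"
    by (rule tendsto_upperbound[OF lim]) auto
  then show ?thesis using \<open>q - p \<le> 0\<close> by simp
qed

lemma continuous_on_Icc_bounded:
  fixes f :: "real \<Rightarrow> real"
  assumes "continuous_on {a..b} f"
  obtains C where "C \<ge> 0" "\<And>x. a \<le> x \<Longrightarrow> x \<le> b \<Longrightarrow> \<bar>f x\<bar> \<le> C"
proof -
  have "compact (f ` {a..b})"
    by (intro compact_continuous_image assms) auto
  then show thesis
    using compact_imp_bounded[of "f ` {a..b}"] that unfolding bounded_pos by (auto dest: less_imp_le)
qed

text \<open>A function with a steep slope at \<open>y\<close> would have to exceed, within distance \<open>r\<close>, the barrier
  \<open>f y + M t - N t\<^sup>2\<close>, which is too concave for a superjet.\<close>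

lemma superjet_slopes_bounded:
  fixes f :: "real \<Rightarrow> real"
  assumes cont: "continuous_on {a..b} f" and AB: "A \<ge> 0" "B \<ge> 0"
    and jet: "\<And>x p X. a < x \<Longrightarrow> x < b \<Longrightarrow> superjet f x p X \<Longrightarrow> - A * \<bar>p\<bar> - B \<le> X"
    and sub: "a < a'" "b' < b"
  shows "\<exists>M. \<forall>x p X. a' < x \<longrightarrow> x < b' \<longrightarrow> superjet f x p X \<longrightarrow> \<bar>p\<bar> \<le> M"
proof -
  obtain C where C: "C \<ge> 0" "\<And>x. a \<le> x \<Longrightarrow> x \<le> b \<Longrightarrow> \<bar>f x\<bar> \<le> C"
    using continuous_on_Icc_bounded[OF cont] by blast
  \<comment> \<open>The first bound gives \<open>2 * N * r \<le> M\<close>, so the barrier slope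
    \<open>M - 2 * N * t\<close> stays between 0 and \<open>M\<close>; the others keep points at
    distance \<open>r\<close> from \<open>{a'..b'}\<close> inside \<open>{a..b}\<close>.\<close>
  define r where "r = min (1 / (2 * (A + 1))) (min (a' - a) (b - b'))"
  have r: "r > 0" "r \<le> a' - a" "r \<le> b - b'" "2 * (A + 1) * r \<le> 1"
  proof -
    show "r > 0" "r \<le> a' - a" "r \<le> b - b'" unfolding r_def using sub AB by auto
    have "r \<le> 1 / (2 * (A + 1))" unfolding r_def by auto
    then show "2 * (A + 1) * r \<le> 1" using AB by (simp add: field_simps)
  qed
  \<comment> \<open>The term \<open>4 * C / r\<close> lifts the barrier by at least
    \<open>2 * C\<close> at \<open>t = r\<close>, above all values of \<open>f\<close>;
    \<open>M > B\<close> and \<open>N = (A + 1) * M\<close> give \<open>2 * N > A * M + B\<close>,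
    so no superjet has the entry \<open>- 2 * N\<close> with a slope of size at most
    \<open>M\<close>.\<close>
  define M where "M = B + 1 + 4 * C / r"
  define N where "N = (A + 1) * M"
  have M: "M > B" "M > 0" "M * r \<ge> 4 * C" "M \<ge> 0"
  proof -
    have "4 * C / r \<ge> 0" using C r by simp
    then show "M > B" "M > 0" "M \<ge> 0" unfolding M_def using AB by linarith+
    show "M * r \<ge> 4 * C" unfolding M_def using AB C r by (simp add: field_simps)
  qed
  have N: "N > 0" "2 * N * r \<le> M"
  proof -
    show "N > 0" unfolding N_def using M AB by auto
    show "2 * N * r \<le> M"
      using mult_left_mono[OF r(4) M(4)] by (simp add: N_def algebra_simps)
  qed
  have lip: "f (y + s * t) \<le> f y + M * t"
    if y: "a' \<le> y" "y \<le> b'" and s: "s = 1 \<or> s = -1" and t: "0 \<le> t" "t \<le> r" for y s t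
  proof -
    define G where "G t = f (y + s * t) - (M * t - N * t\<^sup>2)" for t
    have range: "y + s * t \<in> {a..b}" if "0 \<le> t" "t \<le> r" for t
      using s that r y by auto
    have "continuous_on {0..r} G"
      unfolding G_def using range
      by (intro continuous_intros continuous_on_compose2[OF cont]) auto
    then obtain m where m: "m \<in> {0..r}" "\<And>t. t \<in> {0..r} \<Longrightarrow> G t \<le> G m"
      using continuous_attains_sup[of "{0..r}" G] r by auto
    have "G m \<le> f y"
    proof (rule ccontr)
      assume big: "\<not> G m \<le> f y"
      have "G r \<le> f y"
      proof -
        have "2 * N * r * r \<le> M * r" using N r by (intro mult_right_mono) auto
        then have "4 * C \<le> 2 * (M * r - N * r\<^sup>2)" using M by (simp add: power2_eq_square algebra_simps)
        moreover have "f (y + s * r) \<le> C" "- f y \<le> C"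
          using C(2)[of "y + s * r"] C(2)[of y] range[of r] range[of 0] r by (auto simp: abs_le_iff)
        ultimately show ?thesis unfolding G_def by (simp add: algebra_simps)
      qed
      moreover have "G 0 = f y" by (simp add: G_def)
      ultimately have "m \<noteq> 0" "m \<noteq> r" using big by auto
      then have mm: "0 < m" "m < r" using m by auto
      have jm: "superjet f (y + s * m) (s * (M - 2 * N * m)) (- 2 * N)"
      proof (rule superjetI)
        show "min m (r - m) > 0" using mm by auto
        fix x assume x: "\<bar>x - (y + s * m)\<bar> < min m (r - m)"
        define t where "t = s * (x - y)"
        have xt: "x = y + s * t" using s by (auto simp: t_def)
        have "\<bar>s * (t - m)\<bar> < min m (r - m)" using x unfolding xt by (simp add: algebra_simps)
        then have tm: "\<bar>t - m\<bar> < min m (r - m)" using s by (auto simp: abs_minus_commute)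
        then have "G t \<le> G m" by (intro m) auto
        then have "f x \<le> f (y + s * m) + (M - 2 * N * m) * (t - m) - N * (t - m)\<^sup>2"
          unfolding G_def xt by (simp add: algebra_simps power2_eq_square)
        also have "t - m = s * (x - (y + s * m))" unfolding xt using s by auto
        also have "(s * (x - (y + s * m)))\<^sup>2 = (x - (y + s * m))\<^sup>2"
          using s by (auto simp: power2_commute)
        finally show "f x \<le> f (y + s * m) + s * (M - 2 * N * m) * (x - (y + s * m))
            + - 2 * N / 2 * (x - (y + s * m))\<^sup>2"
          by (simp add: algebra_simps)
      qed
      have "0 \<le> 2 * N * m" "2 * N * m \<le> 2 * N * r" using N mm by auto
      then have "\<bar>s * (M - 2 * N * m)\<bar> \<le> M" using N(2) s by (auto simp: abs_mult)
      then have "A * \<bar>s * (M - 2 * N * m)\<bar> \<le> A * M" using AB by (intro mult_left_mono) auto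
      moreover have "- A * \<bar>s * (M - 2 * N * m)\<bar> - B \<le> - 2 * N"
        using s mm r y by (intro jet[OF _ _ jm]) auto
      ultimately have "2 * N \<le> A * M + B" by linarith
      moreover have "N = A * M + M" by (simp add: N_def algebra_simps)
      moreover have "A * M \<ge> 0" using AB M by auto
      ultimately show False using M by linarith
    qed
    then have "G t \<le> f y" using m(2)[of t] t by auto
    moreover have "N * t\<^sup>2 \<ge> 0" using N by auto
    ultimately show ?thesis unfolding G_def by linarith
  qed
  have "\<bar>p\<bar> \<le> M" if x: "a' < x" "x < b'" and jp: "superjet f x p X" for x p X
  proof -
    obtain d where d: "d > 0" "\<And>y. \<bar>y - x\<bar> < d \<Longrightarrow> f y \<le> f x + p * (y - x) + X / 2 * (y - x)\<^sup>2"
      using superjetE[OF jp] by blast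
    have lim: "((\<lambda>t. M + X / 2 * t) \<longlongrightarrow> M) (at_right 0)"
      by (auto intro!: tendsto_eq_intros)
    \<comment> \<open>The Lipschitz bound, used from \<open>x + s * t\<close> back to
      \<open>x\<close>, meets the superjet bound at \<open>x + s * t\<close>; divide by
      \<open>t\<close> and let \<open>t\<close> tend to 0.\<close>
    have *: "- s * p \<le> M" if s: "s = 1 \<or> s = -1" for s
    proof (rule tendsto_lowerbound[OF lim])
      have "0 < min (min r d) (min (x - a') (b' - x))" using r d x by auto
      then have "\<forall>\<^sub>F t in at_right 0. t < min (min r d) (min (x - a') (b' - x))"
        by (rule order_tendstoD(2)[OF tendsto_ident_at])
      moreover have "\<forall>\<^sub>F t in at_right (0::real). 0 < t" by (simp add: eventually_at_filter)
      ultimately show "\<forall>\<^sub>F t in at_right 0. - s * p \<le> M + X / 2 * t"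
      proof eventually_elim
        case (elim t)
        have "f (x + s * t + (-s) * t) \<le> f (x + s * t) + M * t"
          using elim s by (intro lip) auto
        moreover have "f (x + s * t) \<le> f x + p * (s * t) + X / 2 * (s * t)\<^sup>2"
          using d(2)[of "x + s * t"] s elim by auto
        ultimately have "(- s * p) * t \<le> (M + X / 2 * t) * t"
          using s by (auto simp: algebra_simps power2_eq_square)
        then show ?case using elim by (meson mult_le_cancel_right_pos)
      qed
    qed auto
    show ?thesis using *[of 1] *[of "-1"] by auto
  qed
  then show ?thesis by blast
qed

text \<open>On the smaller interval slopes are bounded, so the slope-dependent lower bound becomes a
  constant and the convexity criterion applies.\<close>

lemma semiconvex_if_superjets_ge:
  fixes f :: "real \<Rightarrow> real"
  assumes cont: "continuous_on {a..b} f" and AB: "A \<ge> 0" "B \<ge> 0"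
    and jet: "\<And>x p X. a < x \<Longrightarrow> x < b \<Longrightarrow> superjet f x p X \<Longrightarrow> - A * \<bar>p\<bar> - B \<le> X"
    and sub: "a < a'" "b' < b"
  shows "\<exists>k. convex_on {a'..b'} (\<lambda>x. f x - k / 2 * x\<^sup>2)"
proof -
  have "\<exists>M. \<forall>x p X. a' < x \<longrightarrow> x < b' \<longrightarrow> superjet f x p X \<longrightarrow> \<bar>p\<bar> \<le> M"
    by (rule superjet_slopes_bounded[OF cont AB _ sub]) (rule jet)
  then obtain M where M: "\<And>x p X. a' < x \<Longrightarrow> x < b' \<Longrightarrow> superjet f x p X \<Longrightarrow> \<bar>p\<bar> \<le> M"
    by blast
  have "convex_on {a'..b'} (\<lambda>x. f x - (- A * M - B) / 2 * x\<^sup>2)"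
  proof (rule convex_on_if_superjets_ge)
    show "continuous_on {a'..b'} f"
      using sub by (intro continuous_on_subset[OF cont]) auto
    fix x p X assume x: "a' < x" "x < b'" and j: "superjet f x p X"
    have "A * \<bar>p\<bar> \<le> A * M" using M[OF x j] AB by (intro mult_left_mono) auto
    moreover have "- A * \<bar>p\<bar> - B \<le> X" using x sub by (intro jet[OF _ _ j]) auto
    ultimately show "- A * M - B \<le> X" by simp
  qed
  then show ?thesis by blast
qed

section \<open>Subgradients and the maximum principle for semiconvex functions\<close>

lemma semiconvex_subgradient:
  fixes f :: "real \<Rightarrow> real"
  assumes conv: "convex_on {a..b} (\<lambda>x. f x - k / 2 * x\<^sup>2)" and x: "a < x" "x < b"
  obtains p where "\<And>y. a \<le> y \<Longrightarrow> y \<le> b \<Longrightarrow> f x + p * (y - x) + k / 2 * (y - x)\<^sup>2 \<le> f y"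
proof -
  define F where "F x = f x - k / 2 * x\<^sup>2" for x
  define q where "q = Inf ((\<lambda>t. (F x - F t) / (x - t)) ` ({x<..} \<inter> {a..b}))"
  have q: "F x + q * (y - x) \<le> F y" if "a \<le> y" "y \<le> b" for y
    unfolding q_def
    by (rule convex_le_Inf_differential[of "{a..b}" F]) (use conv x that in \<open>auto simp: F_def[abs_def]\<close>)
  show thesis
  proof (rule that[of "q + k * x"])
    fix y assume "a \<le> y" "y \<le> b"
    from q[OF this] show "f x + (q + k * x) * (y - x) + k / 2 * (y - x)\<^sup>2 \<le> f y"
      by (simp add: F_def field_simps power2_eq_square)
  qed
qed

text \<open>A superjet forces its slope on the subgradient, whose inequality holds on all of
  \<open>{a..b}\<close>, whereas the superjet is local.\<close>

lemma semiconvex_superjet_below: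
  fixes f :: "real \<Rightarrow> real"
  assumes conv: "convex_on {a..b} (\<lambda>x. f x - k / 2 * x\<^sup>2)" and x: "a < x" "x < b"
    and j: "superjet f x p X" and y: "a \<le> y" "y \<le> b"
  shows "f x + p * (y - x) + k / 2 * (y - x)\<^sup>2 \<le> f y"
proof -
  obtain q where q: "\<And>y. a \<le> y \<Longrightarrow> y \<le> b \<Longrightarrow> f x + q * (y - x) + k / 2 * (y - x)\<^sup>2 \<le> f y"
    using semiconvex_subgradient[OF conv x] by blast
  have "\<forall>\<^sub>F y in at x. f x + q * (y - x) + k / 2 * (y - x)\<^sup>2 \<le> f y"
    unfolding eventually_at using x q
    by (intro exI[of _ "min (x - a) (b - x)"]) (auto simp: dist_real_def)
  from superjet_slope_unique[OF j this] show ?thesis using q y by simp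
qed

text \<open>Near a point where a semiconvex function is pinched between two parabolas, all its superjets
  have almost the same slope, so a nonlinear lower bound \<open>F x (f x) p \<le> X\<close> can be frozen.\<close>

lemma semiconvex_freeze:
  fixes f :: "real \<Rightarrow> real" and F :: "real \<Rightarrow> real \<Rightarrow> real \<Rightarrow> real"
  assumes conv: "convex_on {a..b} (\<lambda>x. f x - k / 2 * x\<^sup>2)" and x0: "a < x0" "x0 < b"
    and cont: "continuous_on {a..b} f"
    and j0: "superjet f x0 p K"
    and jet: "\<And>x p X. a < x \<Longrightarrow> x < b \<Longrightarrow> superjet f x p X \<Longrightarrow> F x (f x) p \<le> X"
    and F: "isCont (\<lambda>(x, w, p). F x w p) (x0, f x0, p)" and "\<eta> > 0"
  shows "\<exists>d>0. convex_on {x0 - d..x0 + d} (\<lambda>x. f x - (F x0 (f x0) p - \<eta>) / 2 * x\<^sup>2)"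
proof -
  obtain e where e: "e > 0"
    "\<And>x w q. dist (x, w, q) (x0, f x0, p) < e \<Longrightarrow> dist (F x w q) (F x0 (f x0) p) < \<eta>"
    using F \<open>\<eta> > 0\<close> unfolding continuous_at_eps_delta by fastforce
  have e': "F x0 (f x0) p - \<eta> < F x w q"
    if "\<bar>x - x0\<bar> < e / 3" "\<bar>w - f x0\<bar> < e / 3" "\<bar>q - p\<bar> < e / 3" for x w q
  proof -
    have "dist (x, w, q) (x0, f x0, p) \<le> dist x x0 + (dist w (f x0) + dist q p)"
      unfolding dist_Pair_Pair
      by (intro order.trans[OF sqrt_sum_squares_le_sum] add_left_mono) auto
    then have "dist (F x w q) (F x0 (f x0) p) < \<eta>"
      using that by (intro e) (auto simp: dist_real_def)
    then show ?thesis by (auto simp: dist_real_def)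
  qed
  have "isCont f x0"
    using cont x0 by (intro continuous_on_interior) auto
  then obtain d1 where d1: "d1 > 0" "\<And>x. \<bar>x - x0\<bar> < d1 \<Longrightarrow> \<bar>f x - f x0\<bar> < e / 3"
    using e unfolding continuous_at_eps_delta dist_real_def by (meson divide_pos_pos zero_less_numeral)
  obtain d2 where d2: "d2 > 0"
    "\<And>y. \<bar>y - x0\<bar> < d2 \<Longrightarrow> f y \<le> f x0 + p * (y - x0) + K / 2 * (y - x0)\<^sup>2"
    using superjetE[OF j0] by blast
  define C where "C = \<bar>k\<bar> + \<bar>K\<bar> + 1"
  have C: "C > 0" by (simp add: C_def)
  have up: "f y \<le> f x0 + p * (y - x0) + C * (y - x0)\<^sup>2" if "\<bar>y - x0\<bar> < d2" for y
  proof -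
    have "K / 2 * (y - x0)\<^sup>2 \<le> C * (y - x0)\<^sup>2" by (intro mult_right_mono) (auto simp: C_def)
    then show ?thesis using d2(2)[OF that] by simp
  qed
  have low: "f x + q * (y - x) - C * (y - x)\<^sup>2 \<le> f y"
    if "a < x" "x < b" "superjet f x q X" "a \<le> y" "y \<le> b" for x y q X
  proof -
    have "- C * (y - x)\<^sup>2 \<le> k / 2 * (y - x)\<^sup>2" by (intro mult_right_mono) (auto simp: C_def)
    then show ?thesis using semiconvex_superjet_below[OF conv that] by simp
  qed
  \<comment> \<open>The thirds leave room for points at distance \<open>2 * d\<close> from
    \<open>x0\<close>; the last entry gives \<open>6 * C * d \<le> e / 4\<close>, below the
    tolerance \<open>e / 3\<close> for slopes.\<close>
  define d where "d = Min {d1, d2 / 3, e / 3, (x0 - a) / 3, (b - x0) / 3, e / (24 * C)}"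
  have "d > 0" unfolding d_def using d1(1) d2(1) e(1) x0 C by (subst Min_gr_iff) auto
  have d: "d \<le> d1" "d \<le> d2 / 3" "d \<le> e / 3" "d \<le> (x0 - a) / 3" "d \<le> (b - x0) / 3" "d \<le> e / (24 * C)"
    unfolding d_def by (intro Min.coboundedI; simp)+
  have Cd: "C * d \<le> e / 24" using d(6) C by (simp add: field_simps)
  have slope: "\<bar>q - p\<bar> < e / 3" if x: "\<bar>x - x0\<bar> < d" and jq: "superjet f x q X" for x q X
  proof -
    \<comment> \<open>The lower parabola at \<open>x\<close> is compared with the upper one at
      \<open>x0\<close> in the point \<open>x + s * d\<close>. The error is
      \<open>C * d\<^sup>2\<close> times 1 + 4 + 1, the last from relating \<open>f x\<close> to
      \<open>f x0\<close>.\<close>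
    have *: "s * (q - p) \<le> 6 * C * d" if s: "s = 1 \<or> s = -1" for s
    proof -
      have xr: "a < x" "x < b" using x d \<open>d > 0\<close> x0 by (auto simp: abs_if split: if_splits)
      have yr: "a \<le> x + s * d" "x + s * d \<le> b" using s x d \<open>d > 0\<close> x0 by (auto simp: abs_if split: if_splits)
      have "\<bar>x + s * d - x0\<bar> \<le> 2 * d" using s x by auto
      then have sq: "C * (x + s * d - x0)\<^sup>2 \<le> C * (2 * d)\<^sup>2"
        using C by (intro mult_left_mono abs_le_square_iff[THEN iffD1]) auto
      have sq2: "C * (x - x0)\<^sup>2 \<le> C * d\<^sup>2"
        using C x by (intro mult_left_mono abs_le_square_iff[THEN iffD1]) auto
      have "f x + q * (s * d) - C * (s * d)\<^sup>2 \<le> f (x + s * d)"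
        using low[OF xr jq yr] by simp
      also have "\<dots> \<le> f x0 + p * (x + s * d - x0) + C * (x + s * d - x0)\<^sup>2"
        using \<open>\<bar>x + s * d - x0\<bar> \<le> 2 * d\<close> d \<open>d > 0\<close> by (intro up) auto
      also have "\<dots> \<le> f x0 + p * (x + s * d - x0) + C * (2 * d)\<^sup>2" using sq by simp
      finally have 1: "f x + q * (s * d) - C * (s * d)\<^sup>2 \<le> f x0 + p * (x + s * d - x0) + C * (2 * d)\<^sup>2" .
      have "f x0 + p * (x - x0) - C * (x - x0)\<^sup>2 \<le> f x"
        using xr x0 by (intro low[OF _ _ j0]) auto
      then have "s * (q - p) * d \<le> 6 * C * d * d"
        using 1 sq2 s by (auto simp add: algebra_simps power2_eq_square)
      then show ?thesis using \<open>d > 0\<close> by simp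
    qed
    have "\<bar>q - p\<bar> \<le> 6 * C * d" using *[of 1] *[of "-1"] by auto
    then show ?thesis using Cd e(1) by linarith
  qed
  have "convex_on {x0 - d..x0 + d} (\<lambda>x. f x - (F x0 (f x0) p - \<eta>) / 2 * x\<^sup>2)"
  proof (rule convex_on_if_superjets_ge)
    show "continuous_on {x0 - d..x0 + d} f"
      using d x0 by (intro continuous_on_subset[OF cont]) auto
    fix x q X assume x: "x0 - d < x" "x < x0 + d" and j: "superjet f x q X"
    have xd: "\<bar>x - x0\<bar> < d" using x by auto
    have "F x0 (f x0) p - \<eta> < F x (f x) q"
      using xd d d1(2)[of x] slope[OF xd j] by (intro e') auto
    also have "\<dots> \<le> X" using x d x0 \<open>d > 0\<close> by (intro jet[OF _ _ j]) auto
    finally show "F x0 (f x0) p - \<eta> \<le> X" by simp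
  qed
  then show ?thesis using \<open>d > 0\<close> by blast
qed

text \<open>In one dimension the theorem on sums follows from convexity alone: with the bounds frozen at
  the contact point, \<open>f + h\<close> is at least as convex as \<open>F + H\<close>.\<close>

lemma semiconvex_maximum_principle:
  fixes f h :: "real \<Rightarrow> real" and F H :: "real \<Rightarrow> real \<Rightarrow> real \<Rightarrow> real"
  assumes x0: "a < x0" "x0 < b"
    and contf: "continuous_on {a..b} f" and conth: "continuous_on {a..b} h"
    and convf: "convex_on {a..b} (\<lambda>x. f x - k / 2 * x\<^sup>2)"
    and convh: "convex_on {a..b} (\<lambda>x. h x - l / 2 * x\<^sup>2)"
    and jetf: "\<And>x p X. a < x \<Longrightarrow> x < b \<Longrightarrow> superjet f x p X \<Longrightarrow> F x (f x) p \<le> X"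
    and jeth: "\<And>x p X. a < x \<Longrightarrow> x < b \<Longrightarrow> superjet h x p X \<Longrightarrow> H x (h x) p \<le> X"
    and contF: "\<And>p X. superjet f x0 p X \<Longrightarrow> isCont (\<lambda>(x, w, p). F x w p) (x0, f x0, p)"
    and contH: "\<And>p X. superjet h x0 p X \<Longrightarrow> isCont (\<lambda>(x, w, p). H x w p) (x0, h x0, p)"
    and contact: "superjet (\<lambda>x. f x + h x) x0 P K"
  shows "\<exists>p X Y. superjet f x0 p X \<and> superjet h x0 (P - p) Y
    \<and> F x0 (f x0) p + H x0 (h x0) (P - p) \<le> K"
proof -
  obtain p where p: "\<And>y. a \<le> y \<Longrightarrow> y \<le> b \<Longrightarrow> f x0 + p * (y - x0) + k / 2 * (y - x0)\<^sup>2 \<le> f y"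
    using semiconvex_subgradient[OF convf x0] by blast
  obtain q where q: "\<And>y. a \<le> y \<Longrightarrow> y \<le> b \<Longrightarrow> h x0 + q * (y - x0) + l / 2 * (y - x0)\<^sup>2 \<le> h y"
    using semiconvex_subgradient[OF convh x0] by blast
  obtain d where d: "d > 0" "\<And>y. \<bar>y - x0\<bar> < d \<Longrightarrow>
      f y + h y \<le> f x0 + h x0 + P * (y - x0) + K / 2 * (y - x0)\<^sup>2"
    using superjetE[OF contact] by blast
  define r where "r = min d (min (x0 - a) (b - x0))"
  have r: "r > 0" "\<And>y. \<bar>y - x0\<bar> < r \<Longrightarrow> \<bar>y - x0\<bar> < d \<and> a \<le> y \<and> y \<le> b"
    unfolding r_def using d x0 by auto
  \<comment> \<open>Subtracting the lower parabola of \<open>h\<close> from the contact bound leaves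
    an upper parabola for \<open>f\<close>; together with the lower one for \<open>f\<close> it
    fixes the slope. Exchanging roles gives \<open>jh\<close>.\<close>
  have jf: "superjet f x0 (P - q) (K - l)"
  proof (rule superjetI[OF r(1)])
    fix y assume "\<bar>y - x0\<bar> < r"
    then show "f y \<le> f x0 + (P - q) * (y - x0) + (K - l) / 2 * (y - x0)\<^sup>2"
      using d(2)[of y] q[of y] r(2)[of y] by (auto simp: algebra_simps diff_divide_distrib)
  qed
  have ev: "\<forall>\<^sub>F y in at x0. f x0 + p * (y - x0) + k / 2 * (y - x0)\<^sup>2 \<le> f y"
    unfolding eventually_at using r p by (intro exI[of _ r]) (auto simp: dist_real_def)
  have Pq: "P - q = p" using superjet_slope_unique[OF jf ev] .
  then have qP: "q = P - p" by simp
  have jh: "superjet h x0 (P - p) (K - k)"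
  proof (rule superjetI[OF r(1)])
    fix y assume "\<bar>y - x0\<bar> < r"
    then show "h y \<le> h x0 + (P - p) * (y - x0) + (K - k) / 2 * (y - x0)\<^sup>2"
      using d(2)[of y] p[of y] r(2)[of y] by (auto simp: algebra_simps diff_divide_distrib)
  qed
  note jf = jf[unfolded Pq]
  have "F x0 (f x0) p + H x0 (h x0) (P - p) \<le> K + \<epsilon>" if "\<epsilon> > 0" for \<epsilon>
  proof -
    define \<alpha> where "\<alpha> = F x0 (f x0) p - \<epsilon> / 2"
    define \<beta> where "\<beta> = H x0 (h x0) (P - p) - \<epsilon> / 2"
    have e2: "\<epsilon> / 2 > 0" using that by simp
    obtain d1 where d1: "d1 > 0" "convex_on {x0 - d1..x0 + d1} (\<lambda>x. f x - \<alpha> / 2 * x\<^sup>2)"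
      unfolding \<alpha>_def
      using semiconvex_freeze[where F = F, OF convf x0 contf jf jetf contF[OF jf] e2] by blast
    obtain d2 where d2: "d2 > 0" "convex_on {x0 - d2..x0 + d2} (\<lambda>x. h x - \<beta> / 2 * x\<^sup>2)"
      unfolding \<beta>_def
      using semiconvex_freeze[where F = H, OF convh x0 conth jh jeth contH[OF jh] e2] by blast
    define t where "t = min (min d1 d2) (d / 2)"
    have t: "t > 0" "t \<le> d1" "t \<le> d2" "t < d" unfolding t_def using d1 d2 d by auto
    have mid: "g x0 \<le> (g (x0 - t) + g (x0 + t)) / 2"
      if "convex_on {x0 - e..x0 + e} g" "t \<le> e" for g :: "real \<Rightarrow> real" and e
      using convex_onD[OF that(1), of "1 / 2" "x0 - t" "x0 + t"] that(2) t(1) by (simp add: field_simps)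
    have "f x0 + h x0 - \<alpha> / 2 * x0\<^sup>2 - \<beta> / 2 * x0\<^sup>2
      \<le> (f (x0 - t) + h (x0 - t) + f (x0 + t) + h (x0 + t)) / 2
        - (\<alpha> + \<beta>) / 2 * ((x0 - t)\<^sup>2 + (x0 + t)\<^sup>2) / 2"
      using mid[OF d1(2) t(2)] mid[OF d2(2) t(3)] by (simp add: field_simps)
    moreover have "f (x0 - t) + h (x0 - t) \<le> f x0 + h x0 - P * t + K / 2 * t\<^sup>2"
      using d(2)[of "x0 - t"] t by simp
    moreover have "f (x0 + t) + h (x0 + t) \<le> f x0 + h x0 + P * t + K / 2 * t\<^sup>2"
      using d(2)[of "x0 + t"] t by simp
    ultimately have "(\<alpha> + \<beta>) * t\<^sup>2 \<le> K * t\<^sup>2"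
      by (simp add: field_simps power2_eq_square)
    then have "\<alpha> + \<beta> \<le> K" using t by simp
    then show ?thesis unfolding \<alpha>_def \<beta>_def by simp
  qed
  then have "F x0 (f x0) p + H x0 (h x0) (P - p) \<le> K" by (rule field_le_epsilon)
  then show ?thesis using jf jh by blast
qed

section \<open>Viscosity inequalities in terms of superjets\<close>

text \<open>The vanishing term \<open>0 / 2 * (x - x0)\<^sup>2\<close> keeps the derivative in the
  shape of the left-hand side, so the rule can be iterated.\<close>

lemma deriv_quadratic:
  fixes A B C x0 :: real
  shows "deriv (\<lambda>x. A + B * (x - x0) + C / 2 * (x - x0)\<^sup>2) = (\<lambda>x. B + C * (x - x0) + 0 / 2 * (x - x0)\<^sup>2)"
  by (rule ext, rule DERIV_imp_deriv) (auto intro!: derivative_eq_intros)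

lemma smooth_fun_quadratic:
  fixes A B C x0 :: real
  shows "smooth_fun (\<lambda>x. A + B * (x - x0) + C / 2 * (x - x0)\<^sup>2)"
proof -
  have "\<exists>A' B' C'. (deriv ^^ n) (\<lambda>x. A + B * (x - x0) + C / 2 * (x - x0)\<^sup>2)
      = (\<lambda>x. A' + B' * (x - x0) + C' / 2 * (x - x0)\<^sup>2)" for n
  proof (induction n)
    case 0
    then show ?case by auto
  next
    case (Suc n)
    then obtain A' B' C' where "(deriv ^^ n) (\<lambda>x. A + B * (x - x0) + C / 2 * (x - x0)\<^sup>2)
        = (\<lambda>x. A' + B' * (x - x0) + C' / 2 * (x - x0)\<^sup>2)" by blast
    then have "(deriv ^^ Suc n) (\<lambda>x. A + B * (x - x0) + C / 2 * (x - x0)\<^sup>2)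
        = (\<lambda>x. B' + C' * (x - x0) + 0 / 2 * (x - x0)\<^sup>2)"
      unfolding funpow.simps o_apply by (simp only: deriv_quadratic)
    then show ?case by blast
  qed
  note iterate = this
  have diff: "(\<lambda>x. A' + B' * (x - x0) + C' / 2 * (x - x0)\<^sup>2) field_differentiable (at x)" for A' B' C' x :: real
    unfolding field_differentiable_def by (rule exI) (auto intro!: derivative_eq_intros)
  show ?thesis
    unfolding smooth_fun_def
  proof (intro allI)
    fix n x
    show "(deriv ^^ n) (\<lambda>x. A + B * (x - x0) + C / 2 * (x - x0)\<^sup>2) field_differentiable at x"
      using iterate[of n] diff by (elim exE) (simp only:)
  qed
qed

definition drift :: "real \<Rightarrow> real \<Rightarrow> real" where
  "drift b x = x\<^sup>2 / (x\<^sup>2 + 1) - b * x"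

text \<open>The parabola itself is the test function. The bound is taken within \<open>S\<close>,
  which covers the endpoint 0; for \<open>p \<ge> 0\<close> the viscosity inequality would be
  void.\<close>

lemma subsolution_jet:
  assumes "viscosity_subsolution_on b \<rho> \<sigma> S w" "x \<in> S" "p < 0"
    and jet: "\<forall>\<^sub>F y in at x within S. w y \<le> w x + p * (y - x) + X / 2 * (y - x)\<^sup>2"
  shows "\<rho> * w x - drift b x * p + ln (- p) + x\<^sup>2 + 1 \<le> 1 / 2 * \<sigma>\<^sup>2 * x\<^sup>2 * X"
proof -
  define \<phi> where "\<phi> = (\<lambda>y. w x + p * (y - x) + X / 2 * (y - x)\<^sup>2)"
  have "local_max_on S (\<lambda>y. w y - \<phi> y) x"
    unfolding local_max_on_def \<phi>_def using assms(2) jet by (auto elim!: eventually_mono)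
  moreover have "smooth_fun \<phi>"
    unfolding \<phi>_def by (rule smooth_fun_quadratic)
  moreover have "deriv \<phi> x = p" "deriv (deriv \<phi>) x = X"
    unfolding \<phi>_def deriv_quadratic by auto
  ultimately have "ereal (\<rho> * w x) - hamiltonian b \<sigma> x p X \<le> 0"
    using assms(1) unfolding viscosity_subsolution_on_def by metis
  then show ?thesis
    using \<open>p < 0\<close> by (simp add: hamiltonian_def drift_def)
qed

text \<open>The negated parabola tests \<open>w\<close> from below. With \<open>p \<le> 0\<close>
  the Hamiltonian would be infinite and violate the supersolution inequality.\<close>

lemma supersolution_jet:
  assumes "viscosity_supersolution_on b \<rho> \<sigma> S w" "x \<in> S"
    and jet: "superjet (\<lambda>x. - w x) x p X"
  shows "p > 0" "- (1 / 2 * \<sigma>\<^sup>2 * x\<^sup>2 * X) \<le> \<rho> * w x + drift b x * p + ln p + x\<^sup>2 + 1"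
proof -
  define \<phi> where "\<phi> = (\<lambda>y. w x + (-p) * (y - x) + (-X) / 2 * (y - x)\<^sup>2)"
  have "local_min_on S (\<lambda>y. w y - \<phi> y) x"
    unfolding local_min_on_def \<phi>_def
    using assms(2) filter_leD[OF at_le[OF subset_UNIV] jet[unfolded superjet_def], of S]
    by (auto elim!: eventually_mono)
  moreover have "smooth_fun \<phi>"
    unfolding \<phi>_def by (rule smooth_fun_quadratic)
  moreover have "deriv \<phi> x = -p" "deriv (deriv \<phi>) x = -X"
    unfolding \<phi>_def deriv_quadratic by auto
  ultimately have *: "ereal (\<rho> * w x) - hamiltonian b \<sigma> x (-p) (-X) \<ge> 0"
    using assms(1) unfolding viscosity_supersolution_on_def by metis
  then show "p > 0"
    by (cases "p > 0") (auto simp: hamiltonian_def)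
  then show "- (1 / 2 * \<sigma>\<^sup>2 * x\<^sup>2 * X) \<le> \<rho> * w x + drift b x * p + ln p + x\<^sup>2 + 1"
    using * by (simp add: hamiltonian_def drift_def)
qed

lemma deriv_le_jet:
  assumes "viscosity_deriv_le_on S w m" "x \<in> S" and jet: "superjet w x p X"
  shows "p \<le> m"
proof -
  define \<phi> where "\<phi> = (\<lambda>y. w x + p * (y - x) + X / 2 * (y - x)\<^sup>2)"
  have "local_max_on S (\<lambda>y. w y - \<phi> y) x"
    unfolding local_max_on_def \<phi>_def
    using assms(2) filter_leD[OF at_le[OF subset_UNIV] jet[unfolded superjet_def], of S]
    by (auto elim!: eventually_mono)
  moreover have "smooth_fun \<phi>"
    unfolding \<phi>_def by (rule smooth_fun_quadratic)
  moreover have "deriv \<phi> x = p"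
    unfolding \<phi>_def deriv_quadratic by auto
  ultimately show ?thesis
    using assms(1) unfolding viscosity_deriv_le_on_def by metis
qed

section \<open>Estimates for the drift and the logarithm\<close>

text \<open>The rational parts differ by \<open>(x - y) * (x + y) / D\<close>, and
  \<open>2 * \<bar>x\<bar> \<le> x\<^sup>2 + 1\<close> bounds \<open>(x + y) / D\<close> by 1 in
  absolute value.\<close>

lemma drift_Lipschitz:
  assumes "b \<ge> 0"
  shows "\<bar>drift b x - drift b y\<bar> \<le> (1 + b) * \<bar>x - y\<bar>"
proof -
  define D where "D = (x\<^sup>2 + 1) * (y\<^sup>2 + 1)"
  have "2 * \<bar>x\<bar> \<le> x\<^sup>2 + 1" "2 * \<bar>y\<bar> \<le> y\<^sup>2 + 1"
    using zero_le_power2[of "\<bar>x\<bar> - 1"] zero_le_power2[of "\<bar>y\<bar> - 1"] by (simp_all add: power2_diff)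
  moreover have "D = 1 + x\<^sup>2 + y\<^sup>2 + x\<^sup>2 * y\<^sup>2" by (simp add: D_def algebra_simps)
  moreover have "x\<^sup>2 * y\<^sup>2 \<ge> 0" by simp
  ultimately have le: "\<bar>x\<bar> + \<bar>y\<bar> \<le> D"
    using zero_le_power2[of x] zero_le_power2[of y] by linarith
  have pos: "x\<^sup>2 + 1 > 0" "y\<^sup>2 + 1 > 0" by (auto intro: add_nonneg_pos)
  then have "D > 0" by (simp add: D_def)
  have "drift b x - drift b y = (x - y) * ((x + y) / D - b)"
    using pos unfolding drift_def D_def by (simp add: divide_simps) (simp add: algebra_simps power2_eq_square)
  moreover have "\<bar>(x + y) / D - b\<bar> \<le> 1 + b"
  proof -
    have "\<bar>x + y\<bar> / D \<le> 1" using le \<open>D > 0\<close> abs_triangle_ineq[of x y] by simp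
    then have "\<bar>(x + y) / D\<bar> \<le> 1" using \<open>D > 0\<close> by simp
    then show ?thesis using assms by linarith
  qed
  ultimately show ?thesis
    using mult_right_mono[of "\<bar>(x + y) / D - b\<bar>" "1 + b" "\<bar>x - y\<bar>"] by (simp add: abs_mult mult.commute)
qed

lemma continuous_drift: "isCont (drift b) x"
  unfolding drift_def[abs_def] by (intro continuous_intros) (auto simp: add_nonneg_eq_0_iff)

text \<open>The first bound serves the penalty at large \<open>x\<close>, the second the contact
  points near 0.\<close>

lemma drift_le: "drift b x \<le> 1 - b * x" "drift b x \<le> x\<^sup>2 - b * x"
proof -
  have "x\<^sup>2 + 1 > 0" by (auto intro: add_nonneg_pos)
  then have "x\<^sup>2 / (x\<^sup>2 + 1) \<le> 1" "x\<^sup>2 / (x\<^sup>2 + 1) \<le> x\<^sup>2"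
    by (simp_all add: divide_simps) (simp add: algebra_simps)
  then show "drift b x \<le> 1 - b * x" "drift b x \<le> x\<^sup>2 - b * x" by (auto simp: drift_def)
qed

text \<open>Meant for a slope \<beta> of \<open>v\<close> and a slope \<open>P + \<beta>\<close> of
  \<open>u\<close>: \<open>ln r \<le> r - 1\<close> at \<open>r = \<beta> / (P + \<beta>)\<close>
  leaves \<open>P\<close> divided by \<open>- (P + \<beta>)\<close>, which is at least
  \<open>1 / c\<close>.\<close>

lemma ln_minus_ln_le:
  fixes \<beta> P c :: real
  assumes "\<beta> < 0" "P + \<beta> \<le> - 1 / c" "c > 0"
  shows "ln (- \<beta>) - ln (- (P + \<beta>)) \<le> c * \<bar>P\<bar>"
proof -
  have m: "- (P + \<beta>) \<ge> 1 / c" "1 / c > 0" using assms by auto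
  then have pos: "- (P + \<beta>) > 0" by linarith
  have "ln (- \<beta>) - ln (- (P + \<beta>)) = ln ((- \<beta>) / (- (P + \<beta>)))"
    using ln_div[of "- \<beta>" "- (P + \<beta>)"] assms(1) pos by simp
  also have "\<dots> \<le> (- \<beta>) / (- (P + \<beta>)) - 1"
    using assms pos by (intro ln_le_minus_one divide_pos_pos) auto
  also have "\<dots> = P / (- (P + \<beta>))" using pos by (simp add: divide_simps)
  also have "\<dots> \<le> \<bar>P\<bar> / (- (P + \<beta>))" using pos by (intro divide_right_mono) auto
  also have "\<dots> \<le> \<bar>P\<bar> / (1 / c)" using m pos by (intro divide_left_mono) auto
  finally show ?thesis by (simp add: mult.commute)
qed

section \<open>Comparison at a local maximum\<close>

text \<open>The viscosity conditions enter through superjets at \<open>x > 0\<close>, with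
  \<open>c\<close> in the place of \<open>cstar\<close>; the condition at 0 is a hypothesis of
  \<open>boundary\<close>.\<close>

locale lake_pair =
  fixes b \<rho> \<sigma> c :: real and u v :: "real \<Rightarrow> real"
  assumes b_pos: "b > 0" and \<rho>_pos: "\<rho> > 0" and c_pos: "c > 0"
    and cont_u: "continuous_on {0..} u" and cont_v: "continuous_on {0..} v"
    and sub: "\<And>x p X. x > 0 \<Longrightarrow> superjet u x p X \<Longrightarrow>
      p \<le> - 1 / c \<and> \<rho> * u x - drift b x * p + ln (- p) + x\<^sup>2 + 1 \<le> 1 / 2 * \<sigma>\<^sup>2 * x\<^sup>2 * X"
    and super: "\<And>x p X. x > 0 \<Longrightarrow> superjet (\<lambda>x. - v x) x p X \<Longrightarrow>
      p > 0 \<and> - (1 / 2 * \<sigma>\<^sup>2 * x\<^sup>2 * X) \<le> \<rho> * v x + drift b x * p + ln p + x\<^sup>2 + 1"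
begin

section \<open>Contact at an interior point\<close>

text \<open>As \<open>s x > 0\<close>, both inequalities can be solved for the second-order entry,
  with lower bounds \<open>F\<close> for \<open>u\<close> and \<open>H\<close> for
  \<open>- v\<close>; once semiconvexity is known, the one-dimensional maximum principle
  applies.\<close>

lemma interior_second_order:
  assumes "\<sigma> \<noteq> 0" and x0: "x0 > 0" and contact: "superjet (\<lambda>x. u x - v x) x0 P K"
  shows "\<rho> * (u x0 - v x0) \<le> drift b x0 * P + c * \<bar>P\<bar> + 1 / 2 * \<sigma>\<^sup>2 * x0\<^sup>2 * K"
proof -
  define s where "s x = 1 / 2 * \<sigma>\<^sup>2 * x\<^sup>2" for x
  define F where "F x w p = (\<rho> * w - drift b x * p + ln (- p) + x\<^sup>2 + 1) / s x" for x w p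
  define H where "H x w p = - F x (- w) (- p)" for x w p
  have s: "s x > 0" if "x > 0" for x using that \<open>\<sigma> \<noteq> 0\<close> by (simp add: s_def)
  have jetu: "F x (u x) p \<le> X" if "x > 0" "superjet u x p X" for x p X
    using sub[OF that] s[OF that(1)] unfolding F_def s_def[symmetric] by (simp add: divide_simps mult.commute)
  have jetv: "H x (- v x) p \<le> X" if "x > 0" "superjet (\<lambda>x. - v x) x p X" for x p X
    using super[OF that] s[OF that(1)] unfolding H_def F_def s_def[symmetric] by (simp add: divide_simps mult.commute)
  define a1 where "a1 = x0 / 4"
  define b1 where "b1 = 2 * x0"
  have ab: "0 < a1" "a1 < x0 / 2" "3 * x0 / 2 < b1" using x0 by (auto simp: a1_def b1_def)
  have cu: "continuous_on {a1..b1} u" and cv: "continuous_on {a1..b1} v"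
    using ab by (auto intro!: continuous_on_subset[OF cont_u] continuous_on_subset[OF cont_v])
  obtain Cu where Cu: "Cu \<ge> 0" "\<And>x. a1 \<le> x \<Longrightarrow> x \<le> b1 \<Longrightarrow> \<bar>u x\<bar> \<le> Cu"
    using continuous_on_Icc_bounded[OF cu] by blast
  obtain Cv where Cv: "Cv \<ge> 0" "\<And>x. a1 \<le> x \<Longrightarrow> x \<le> b1 \<Longrightarrow> \<bar>v x\<bar> \<le> Cv"
    using continuous_on_Icc_bounded[OF cv] by blast
  obtain G where G: "G \<ge> 0" "\<And>x. a1 \<le> x \<Longrightarrow> x \<le> b1 \<Longrightarrow> \<bar>drift b x\<bar> \<le> G"
    using continuous_on_Icc_bounded[of a1 b1 "drift b"]
      continuous_at_imp_continuous_on[of "{a1..b1}" "drift b"] continuous_drift by blast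
  have s_ge: "s a1 \<le> s x" if "a1 \<le> x" for x
    unfolding s_def using that ab by (intro mult_left_mono power_mono) auto
  \<comment> \<open>For \<open>X \<ge> 0\<close> the bound is trivial; for \<open>X < 0\<close> the
    weight \<open>s x\<close> may be replaced by the smaller \<open>s a1\<close>, which makes the
    bound uniform in \<open>x\<close>.\<close>
  have growth: "- (A / s a1) * \<bar>p\<bar> - B / s a1 \<le> X"
    if "a1 \<le> x" "- A * \<bar>p\<bar> - B \<le> s x * X" "A \<ge> 0" "B \<ge> 0" for x p X A B
  proof (cases "X \<ge> 0")
    case True
    have "- (A / s a1) * \<bar>p\<bar> - B / s a1 \<le> 0"
    proof -
      have "A / s a1 * \<bar>p\<bar> \<ge> 0" "B / s a1 \<ge> 0" using that s[of a1] ab by auto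
      then show ?thesis by linarith
    qed
    then show ?thesis using True by linarith
  next
    case False
    then have "s x * X \<le> s a1 * X" using s_ge[OF that(1)] by (simp add: mult_right_mono_neg)
    then have "- A * \<bar>p\<bar> - B \<le> s a1 * X" using that by linarith
    then show ?thesis using s[of a1] ab by (simp add: field_simps)
  qed
  have gu: "- (G / s a1) * \<bar>p\<bar> - (\<rho> * Cu + \<bar>ln (1 / c)\<bar>) / s a1 \<le> X"
    if x: "a1 < x" "x < b1" and j: "superjet u x p X" for x p X
  proof (rule growth)
    have p: "p \<le> - 1 / c" and le: "\<rho> * u x - drift b x * p + ln (- p) + x\<^sup>2 + 1 \<le> s x * X"
      using sub[OF _ j] x ab by (auto simp: s_def)
    have "\<bar>drift b x * p\<bar> \<le> G * \<bar>p\<bar>"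
      unfolding abs_mult using G(2)[of x] x by (intro mult_right_mono) auto
    moreover have "\<bar>\<rho> * u x\<bar> \<le> \<rho> * Cu"
      unfolding abs_mult using Cu(2)[of x] x \<rho>_pos by auto
    moreover have "ln (1 / c) \<le> ln (- p)" using p c_pos by (intro ln_mono) auto
    moreover have "x\<^sup>2 \<ge> 0" by simp
    ultimately show "- G * \<bar>p\<bar> - (\<rho> * Cu + \<bar>ln (1 / c)\<bar>) \<le> s x * X" using le by linarith
  qed (use x G Cu \<rho>_pos in auto)
  \<comment> \<open>Here the logarithm is bounded above, and \<open>ln p \<le> \<bar>p\<bar>\<close>
    accounts for \<open>G + 1\<close>; for \<open>u\<close> the slope bound kept it above
    \<open>ln (1 / c)\<close>.\<close>
  have gv: "- ((G + 1) / s a1) * \<bar>p\<bar> - (\<rho> * Cv + b1\<^sup>2 + 1) / s a1 \<le> X"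
    if x: "a1 < x" "x < b1" and j: "superjet (\<lambda>x. - v x) x p X" for x p X
  proof (rule growth)
    have p: "p > 0" and le: "- (s x * X) \<le> \<rho> * v x + drift b x * p + ln p + x\<^sup>2 + 1"
      using super[OF _ j] x ab by (auto simp: s_def)
    have "\<bar>drift b x * p\<bar> \<le> G * \<bar>p\<bar>"
      unfolding abs_mult using G(2)[of x] x by (intro mult_right_mono) auto
    moreover have "\<bar>\<rho> * v x\<bar> \<le> \<rho> * Cv"
      unfolding abs_mult using Cv(2)[of x] x \<rho>_pos by auto
    moreover have "ln p \<le> \<bar>p\<bar>" using p ln_le_minus_one[of p] by linarith
    moreover have "x\<^sup>2 \<le> b1\<^sup>2" using x ab by (intro power_mono) auto
    moreover have "- (G + 1) * \<bar>p\<bar> = - (G * \<bar>p\<bar>) - \<bar>p\<bar>" by (simp add: algebra_simps)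
    ultimately show "- (G + 1) * \<bar>p\<bar> - (\<rho> * Cv + b1\<^sup>2 + 1) \<le> s x * X" using le by linarith
  qed (use x G Cv \<rho>_pos in auto)
  have sa: "s a1 > 0" using s ab by auto
  have "\<exists>k. convex_on {x0 / 2..3 * x0 / 2} (\<lambda>x. u x - k / 2 * x\<^sup>2)"
    by (rule semiconvex_if_superjets_ge[OF cu _ _ _ ab(2,3), of "G / s a1" "(\<rho> * Cu + \<bar>ln (1 / c)\<bar>) / s a1"])
      (use gu G Cu \<rho>_pos sa in auto)
  then obtain k where convu: "convex_on {x0 / 2..3 * x0 / 2} (\<lambda>x. u x - k / 2 * x\<^sup>2)" by blast
  have "\<exists>k. convex_on {x0 / 2..3 * x0 / 2} (\<lambda>x. - v x - k / 2 * x\<^sup>2)"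
    by (rule semiconvex_if_superjets_ge[OF _ _ _ _ ab(2,3), of _ "(G + 1) / s a1" "(\<rho> * Cv + b1\<^sup>2 + 1) / s a1"])
      (use gv G Cv \<rho>_pos sa in \<open>auto intro!: continuous_intros cv\<close>)
  then obtain l where convv: "convex_on {x0 / 2..3 * x0 / 2} (\<lambda>x. - v x - l / 2 * x\<^sup>2)" by blast
  have contF: "isCont (\<lambda>(x, w, p). F x w p) (x0, w0, p0)" if "p0 < 0" for w0 p0
    unfolding isCont_def case_prod_beta F_def s_def using that x0 \<open>\<sigma> \<noteq> 0\<close>
    by (auto intro!: tendsto_eq_intros isCont_tendsto_compose[OF continuous_drift])
  have contH: "isCont (\<lambda>(x, w, p). H x w p) (x0, w0, p0)" if "p0 > 0" for w0 p0
    unfolding isCont_def case_prod_beta H_def F_def s_def using that x0 \<open>\<sigma> \<noteq> 0\<close>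
    by (auto intro!: tendsto_eq_intros isCont_tendsto_compose[OF continuous_drift])
  have "\<exists>p X Y. superjet u x0 p X \<and> superjet (\<lambda>x. - v x) x0 (P - p) Y
      \<and> F x0 (u x0) p + H x0 (- v x0) (P - p) \<le> K"
  proof (rule semiconvex_maximum_principle[where F = F and H = H, OF _ _ _ _ convu convv])
    show "continuous_on {x0 / 2..3 * x0 / 2} u" "continuous_on {x0 / 2..3 * x0 / 2} (\<lambda>x. - v x)"
      using ab by (auto intro!: continuous_intros continuous_on_subset[OF cu] continuous_on_subset[OF cv])
    show "isCont (\<lambda>(x, w, p). F x w p) (x0, u x0, p)" if "superjet u x0 p X" for p X
      using sub[OF x0 that] c_pos by (intro contF) (auto intro: le_less_trans)
    show "isCont (\<lambda>(x, w, p). H x w p) (x0, - v x0, p)" if "superjet (\<lambda>x. - v x) x0 p X" for p X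
      using super[OF x0 that] by (intro contH) auto
  qed (use x0 contact jetu jetv in auto)
  then obtain p X Y where p: "superjet u x0 p X" "superjet (\<lambda>x. - v x) x0 (P - p) Y"
    and le: "F x0 (u x0) p + H x0 (- v x0) (P - p) \<le> K" by blast
  have pc: "p \<le> - 1 / c" using sub[OF x0 p(1)] by auto
  have "P - p > 0" using super[OF x0 p(2)] by auto
  then have ln: "ln (- (p - P)) - ln (- (P + (p - P))) \<le> c * \<bar>P\<bar>"
    using pc c_pos by (intro ln_minus_ln_le) auto
  have "F x0 (u x0) p + H x0 (- v x0) (P - p)
      = (\<rho> * (u x0 - v x0) - drift b x0 * P + ln (- p) - ln (P - p)) / s x0"
    unfolding H_def F_def by (simp add: algebra_simps diff_divide_distrib[symmetric] add_divide_distrib[symmetric])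
  then have "\<rho> * (u x0 - v x0) - drift b x0 * P + ln (- p) - ln (P - p) \<le> s x0 * K"
    using mult_left_mono[OF le, of "s x0"] s[OF x0] by simp
  then show ?thesis using ln unfolding s_def by (simp add: algebra_simps)
qed

text \<open>With \<open>\<sigma> = 0\<close> the second-order entries drop out, so the large entries
  \<open>Q + real n\<close> and \<open>real n\<close> produced by doubling do no harm.\<close>

lemma interior_first_order:
  assumes "\<sigma> = 0" and x0: "x0 > 0" and contact: "superjet (\<lambda>x. u x - v x) x0 P K"
  shows "\<rho> * (u x0 - v x0) \<le> drift b x0 * P + c * \<bar>P\<bar>"
proof -
  obtain d where d: "d > 0" "\<And>x. \<bar>x - x0\<bar> < d \<Longrightarrow>
      u x - v x \<le> u x0 - v x0 + P * (x - x0) + K / 2 * (x - x0)\<^sup>2"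
    using superjetE[OF contact] by blast
  define r where "r = min (d / 2) (x0 / 2)"
  \<comment> \<open>The extra 1 makes the contact strict: it leaves the term
    \<open>- 1 / 2 * (x - x0)\<^sup>2\<close> that drives \<open>X n\<close> to
    \<open>x0\<close>.\<close>
  define Q where "Q = K + 1"
  define S where "S = {x0 - r..x0 + r}"
  have r: "r > 0" "r < d" "r < x0" using d x0 by (auto simp: r_def)
  have Spos: "x > 0" if "x \<in> S" for x using that r by (auto simp: S_def)
  have uv: "u x - v x \<le> u x0 - v x0 + P * (x - x0) + Q / 2 * (x - x0)\<^sup>2 - 1 / 2 * (x - x0)\<^sup>2" if "x \<in> S" for x
    using d(2)[of x] that r by (auto simp: Q_def S_def algebra_simps add_divide_distrib)
  have cu: "continuous_on S u" and cv: "continuous_on S v"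
    using r by (auto simp: S_def intro!: continuous_on_subset[OF cont_u] continuous_on_subset[OF cont_v])
  \<comment> \<open>The contact parabola depends on \<open>x\<close> alone, so the slopes at the
    maximum are \<open>R n + \<beta>\<close> for \<open>u\<close> and \<beta> for
    \<open>v\<close>.\<close>
  define \<Psi> where "\<Psi> n = (\<lambda>(x, y). u x - v y - P * (x - x0) - Q / 2 * (x - x0)\<^sup>2 - real n / 2 * (x - y)\<^sup>2)" for n
  have "\<forall>n. \<exists>z\<in>S \<times> S. \<forall>z'\<in>S \<times> S. \<Psi> n z' \<le> \<Psi> n z"
  proof (rule allI, rule continuous_attains_sup)
    fix n
    show "compact (S \<times> S)" by (auto simp: S_def intro!: compact_Times)
    show "S \<times> S \<noteq> {}" using r by (auto simp: S_def)
    show "continuous_on (S \<times> S) (\<Psi> n)"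
      unfolding \<Psi>_def case_prod_beta
      by (intro continuous_intros continuous_on_compose2[OF cu] continuous_on_compose2[OF cv]) auto
  qed
  then have "\<exists>Z. \<forall>n. Z n \<in> S \<times> S \<and> (\<forall>z'\<in>S \<times> S. \<Psi> n z' \<le> \<Psi> n (Z n))"
    unfolding Bex_def by (rule choice)
  then obtain Z where Z: "\<And>n. Z n \<in> S \<times> S" "\<And>n z. z \<in> S \<times> S \<Longrightarrow> \<Psi> n z \<le> \<Psi> n (Z n)"
    by blast
  define X where "X n = fst (Z n)" for n
  define Y where "Y n = snd (Z n)" for n
  have XY: "X n \<in> S" "Y n \<in> S" for n
    using Z(1)[of n] by (auto simp: X_def Y_def mem_Times_iff)
  have max: "\<Psi> n (x, y) \<le> \<Psi> n (X n, Y n)" if "x \<in> S" "y \<in> S" for n x y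
    using Z(2)[of "(x, y)" n] that by (simp add: X_def Y_def)
  have x0S: "x0 \<in> S" using r by (auto simp: S_def)
  have base: "u x0 - v x0 \<le> u (X n) - v (Y n) - P * (X n - x0) - Q / 2 * (X n - x0)\<^sup>2 - real n / 2 * (X n - Y n)\<^sup>2" for n
    using max[OF x0S x0S, of n] by (simp add: \<Psi>_def)
  have gap: "real n / 2 * (X n - Y n)\<^sup>2 + 1 / 2 * (X n - x0)\<^sup>2 \<le> v (X n) - v (Y n)" for n
    using base[of n] uv[OF XY(1)[of n]] by linarith
  obtain C where "\<And>x. x0 - r \<le> x \<Longrightarrow> x \<le> x0 + r \<Longrightarrow> \<bar>v x\<bar> \<le> C"
    using continuous_on_Icc_bounded[OF cv[unfolded S_def]] by blast
  then have C: "\<bar>v x\<bar> \<le> C" if "x \<in> S" for x using that by (simp add: S_def)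
  \<comment> \<open>Boundedness of \<open>v\<close> in \<open>gap\<close> sends
    \<open>X n - Y n\<close> to 0; uniform continuity of \<open>v\<close> then sends the right side
    of \<open>gap\<close> to 0, and with it the penalty \<open>real n * (X n - Y n)\<^sup>2\<close>
    and \<open>X n - x0\<close>.\<close>
  have "(\<lambda>n. (X n - Y n)\<^sup>2) \<longlonglongrightarrow> 0"
  proof (rule tendsto_sandwich[where f = "\<lambda>_. 0"])
    show "(\<lambda>n. 4 * C / real n) \<longlonglongrightarrow> 0"
      by (rule lim_const_over_n)
    show "\<forall>\<^sub>F n in sequentially. (X n - Y n)\<^sup>2 \<le> 4 * C / real n"
      using eventually_gt_at_top[of 0]
    proof eventually_elim
      case (elim n)
      have "v (X n) \<le> C" "- v (Y n) \<le> C"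
        using C[OF XY(1)[of n]] C[OF XY(2)[of n]] by (auto simp: abs_le_iff)
      then have "real n / 2 * (X n - Y n)\<^sup>2 \<le> 2 * C"
        using gap[of n] zero_le_power2[of "X n - x0"] by linarith
      then show ?case using elim by (simp add: pos_le_divide_eq mult.commute)
    qed
  qed auto
  then have XY0: "(\<lambda>n. X n - Y n) \<longlonglongrightarrow> 0" by (simp add: power_tendsto_0_iff)
  have "uniformly_continuous_on S v"
    using cv by (intro compact_uniformly_continuous) (auto simp: S_def)
  then have "(\<lambda>n. dist (v (X n)) (v (Y n))) \<longlonglongrightarrow> 0"
    unfolding uniformly_continuous_on_sequentially
    using XY XY0 by (elim allE[of _ X] allE[of _ Y] impE) (simp_all add: dist_real_def tendsto_rabs_zero_iff)
  then have vXY: "(\<lambda>n. v (X n) - v (Y n)) \<longlonglongrightarrow> 0"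
    by (simp add: dist_real_def tendsto_rabs_zero_iff)
  have halves: "m * z \<le> 2 * d" "w \<le> 2 * d"
    if "m / 2 * z + 1 / 2 * w \<le> d" "0 \<le> w" "0 \<le> m" "0 \<le> z" for m z w d :: real
  proof -
    define y where "y = m * z"
    have "y \<ge> 0" using that by (simp add: y_def)
    moreover have "y / 2 + w / 2 \<le> d" using that by (simp add: y_def)
    ultimately show "m * z \<le> 2 * d" "w \<le> 2 * d"
      unfolding y_def[symmetric] using \<open>0 \<le> w\<close> by linarith+
  qed
  have pen: "(\<lambda>n. real n * (X n - Y n)\<^sup>2) \<longlonglongrightarrow> 0"
  proof (rule tendsto_sandwich[where f = "\<lambda>_. 0"])
    show "(\<lambda>n. 2 * (v (X n) - v (Y n))) \<longlonglongrightarrow> 0" by (rule tendsto_mult_right_zero[OF vXY])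
    have "real n * (X n - Y n)\<^sup>2 \<le> 2 * (v (X n) - v (Y n))" for n
      by (rule halves(1)[OF gap]) auto
    then show "\<forall>\<^sub>F n in sequentially. real n * (X n - Y n)\<^sup>2 \<le> 2 * (v (X n) - v (Y n))" by simp
  qed auto
  have "(\<lambda>n. (X n - x0)\<^sup>2) \<longlonglongrightarrow> 0"
  proof (rule tendsto_sandwich[where f = "\<lambda>_. 0"])
    show "(\<lambda>n. 2 * (v (X n) - v (Y n))) \<longlonglongrightarrow> 0" by (rule tendsto_mult_right_zero[OF vXY])
    have "(X n - x0)\<^sup>2 \<le> 2 * (v (X n) - v (Y n))" for n
      by (rule halves(2)[OF gap]) auto
    then show "\<forall>\<^sub>F n in sequentially. (X n - x0)\<^sup>2 \<le> 2 * (v (X n) - v (Y n))" by simp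
  qed auto
  then have "(\<lambda>n. X n - x0) \<longlonglongrightarrow> 0" by (simp add: power_tendsto_0_iff)
  then have X0: "X \<longlonglongrightarrow> x0" by (simp add: LIM_zero_iff)
  have Y0: "Y \<longlonglongrightarrow> x0" using tendsto_diff[OF X0 XY0] by simp
  define R where "R n = P + Q * (X n - x0)" for n
  have "\<forall>\<^sub>F n in sequentially. \<rho> * (u x0 - v x0 + P * (X n - x0) + Q / 2 * (X n - x0)\<^sup>2)
      \<le> drift b (X n) * R n + (1 + b) * (real n * (X n - Y n)\<^sup>2) + c * \<bar>R n\<bar> + (Y n)\<^sup>2 - (X n)\<^sup>2"
  proof -
    have ev: "\<forall>\<^sub>F n in sequentially. \<bar>X n - x0\<bar> < r" "\<forall>\<^sub>F n in sequentially. \<bar>Y n - x0\<bar> < r"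
      using tendstoD[OF X0 r(1)] tendstoD[OF Y0 r(1)] by (simp_all add: dist_real_def)
    show ?thesis using ev
    proof eventually_elim
      case (elim n)
      define \<beta> where "\<beta> = real n * (X n - Y n)"
      have ju: "superjet u (X n) (R n + \<beta>) (Q + real n)"
      proof (rule superjetI[of "r - \<bar>X n - x0\<bar>"])
        fix x assume "\<bar>x - X n\<bar> < r - \<bar>X n - x0\<bar>"
        then have "x \<in> S" by (auto simp: S_def abs_if split: if_splits)
        from max[OF this XY(2)[of n], of n]
        show "u x \<le> u (X n) + (R n + \<beta>) * (x - X n) + (Q + real n) / 2 * (x - X n)\<^sup>2"
          unfolding \<Psi>_def R_def \<beta>_def by (simp add: field_simps power2_eq_square)
      qed (use elim in auto)
      have jv: "superjet (\<lambda>x. - v x) (Y n) (- \<beta>) (real n)"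
      proof (rule superjetI[of "r - \<bar>Y n - x0\<bar>"])
        fix x assume "\<bar>x - Y n\<bar> < r - \<bar>Y n - x0\<bar>"
        then have "x \<in> S" by (auto simp: S_def abs_if split: if_splits)
        from max[OF XY(1)[of n] this, of n]
        show "- v x \<le> - v (Y n) + (- \<beta>) * (x - Y n) + real n / 2 * (x - Y n)\<^sup>2"
          unfolding \<Psi>_def R_def \<beta>_def by (simp add: field_simps power2_eq_square)
      qed (use elim in auto)
      have U: "R n + \<beta> \<le> - 1 / c"
        "\<rho> * u (X n) - drift b (X n) * (R n + \<beta>) + ln (- (R n + \<beta>)) + (X n)\<^sup>2 + 1 \<le> 0"
        using sub[OF Spos[OF XY(1)] ju] \<open>\<sigma> = 0\<close> by auto
      have V: "- \<beta> > 0" "0 \<le> \<rho> * v (Y n) + drift b (Y n) * (- \<beta>) + ln (- \<beta>) + (Y n)\<^sup>2 + 1"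
        using super[OF Spos[OF XY(2)] jv] \<open>\<sigma> = 0\<close> by auto
      have L: "ln (- \<beta>) - ln (- (R n + \<beta>)) \<le> c * \<bar>R n\<bar>"
        using U V c_pos by (intro ln_minus_ln_le) auto
      \<comment> \<open>The Lipschitz bound on the drift, times the unbounded slope \<beta>, is a
        multiple of the penalty, which vanishes in the limit.\<close>
      have "\<bar>drift b (X n) - drift b (Y n)\<bar> * \<bar>\<beta>\<bar> \<le> (1 + b) * \<bar>X n - Y n\<bar> * \<bar>\<beta>\<bar>"
        using drift_Lipschitz[of b] b_pos by (intro mult_right_mono) auto
      also have "\<dots> = (1 + b) * (real n * (X n - Y n)\<^sup>2)"
        by (simp add: \<beta>_def abs_mult power2_eq_square)
      finally have D: "(drift b (X n) - drift b (Y n)) * \<beta> \<le> (1 + b) * (real n * (X n - Y n)\<^sup>2)"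
        using abs_ge_self[of "(drift b (X n) - drift b (Y n)) * \<beta>"] unfolding abs_mult by linarith
      have "s + p + q \<le> t" if "s \<le> t - p - q - y" "y \<ge> 0" for s t p q y :: real
        using that by linarith
      from this[OF base] have "u x0 - v x0 + P * (X n - x0) + Q / 2 * (X n - x0)\<^sup>2 \<le> u (X n) - v (Y n)"
        by simp
      then have "\<rho> * (u x0 - v x0 + P * (X n - x0) + Q / 2 * (X n - x0)\<^sup>2) \<le> \<rho> * (u (X n) - v (Y n))"
        using \<rho>_pos by simp
      then show ?case using U(2) V(2) L D by (simp add: algebra_simps)
    qed
  qed
  moreover have lhs: "(\<lambda>n. \<rho> * (u x0 - v x0 + P * (X n - x0) + Q / 2 * (X n - x0)\<^sup>2))
      \<longlonglongrightarrow> \<rho> * (u x0 - v x0 + P * (x0 - x0) + Q / 2 * (x0 - x0)\<^sup>2)"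
    by (intro tendsto_intros X0)
  moreover have rhs: "(\<lambda>n. drift b (X n) * R n + (1 + b) * (real n * (X n - Y n)\<^sup>2) + c * \<bar>R n\<bar> + (Y n)\<^sup>2 - (X n)\<^sup>2)
      \<longlonglongrightarrow> drift b x0 * (P + Q * (x0 - x0)) + (1 + b) * 0 + c * \<bar>P + Q * (x0 - x0)\<bar> + x0\<^sup>2 - x0\<^sup>2"
    unfolding R_def by (intro tendsto_intros X0 Y0 pen isCont_tendsto_compose[OF continuous_drift])
  ultimately have "\<rho> * (u x0 - v x0 + P * (x0 - x0) + Q / 2 * (x0 - x0)\<^sup>2)
      \<le> drift b x0 * (P + Q * (x0 - x0)) + (1 + b) * 0 + c * \<bar>P + Q * (x0 - x0)\<bar> + x0\<^sup>2 - x0\<^sup>2"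
    by (intro tendsto_le[OF sequentially_bot rhs lhs])
  then show ?thesis by simp
qed

lemma interior:
  assumes "x0 > 0" "superjet (\<lambda>x. u x - v x) x0 P K"
  shows "\<rho> * (u x0 - v x0) \<le> drift b x0 * P + c * \<bar>P\<bar> + 1 / 2 * \<sigma>\<^sup>2 * x0\<^sup>2 * K"
  using interior_first_order[OF _ assms] interior_second_order[OF _ assms] by (cases "\<sigma> = 0") auto

section \<open>Contact at the boundary point 0\<close>

text \<open>Touching \<open>v\<close> from below near \<open>0\<close> with \<open>- w y - \<delta> / y\<close> keeps the contact point away from \<open>0\<close>;
  comparing with the value at \<open>y2\<close> makes \<open>\<delta> / m\<close>, which controls the second-order term, small.\<close>

lemma supersolution_near_zero:
  assumes anti: "\<And>x y. 0 \<le> x \<Longrightarrow> x \<le> y \<Longrightarrow> v y \<le> v x"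
    and y1: "y1 > 0" and "\<eta> > 0" and w: "w > \<eta>" and steep: "v 0 + \<eta> * y1 < v y1 + w * y1"
  shows "0 \<le> \<rho> * v 0 + ln w + 1 + (1 + w) * y1\<^sup>2 + \<sigma>\<^sup>2 * (v 0 + \<eta> * y1 - v y1)"
proof -
  have wpos: "w > 0" using w \<open>\<eta> > 0\<close> by simp
  \<comment> \<open>Both \<open>w * y2\<close> and \<open>\<delta> / y2\<close> equal
    \<open>\<eta> * y1 / 2\<close>, so \<open>f y2\<close> is at most
    \<open>v 0 + \<eta> * y1\<close>, which \<open>steep\<close> puts below
    \<open>f y1\<close>.\<close>
  define y2 where "y2 = \<eta> * y1 / (2 * w)"
  define \<delta> where "\<delta> = y2 * (\<eta> * y1 / 2)"
  define f where "f y = v y + w * y + \<delta> / y" for y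
  have y2: "y2 > 0" "w * y2 = \<eta> * y1 / 2" "y2 < y1"
  proof -
    show "y2 > 0" "w * y2 = \<eta> * y1 / 2" using wpos \<open>\<eta> > 0\<close> y1 by (simp_all add: y2_def)
    have "\<eta> * y1 < (2 * w) * y1" using wpos w y1 by (intro mult_strict_right_mono) auto
    then show "y2 < y1" using wpos by (simp add: y2_def divide_less_eq mult.commute)
  qed
  have \<delta>: "\<delta> > 0" "\<delta> / y2 = \<eta> * y1 / 2" using y2 \<open>\<eta> > 0\<close> y1 by (simp_all add: \<delta>_def)
  have fy2: "f y2 \<le> v 0 + \<eta> * y1" using anti[of 0 y2] y2 \<delta>(2) unfolding f_def by linarith
  have fy1: "f y2 < f y1"
  proof -
    have "\<delta> / y1 > 0" using \<delta> y1 by simp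
    then show ?thesis using fy2 steep unfolding f_def by linarith
  qed
  \<comment> \<open>At \<open>y3\<close> the barrier term is at least \<open>B\<close>, which lifts
    \<open>f y3\<close> above \<open>f y2\<close>; the minimum over \<open>{y3..y1}\<close> is
    therefore interior.\<close>
  define B where "B = \<bar>f y2 - v y1\<bar> + 1"
  define y3 where "y3 = min y2 (\<delta> / B)"
  have B: "B > 0" by (simp add: B_def)
  have y3: "y3 > 0" "y3 \<le> y2" "B \<le> \<delta> / y3"
  proof -
    show "y3 > 0" "y3 \<le> y2" using y2 \<delta> B by (simp_all add: y3_def)
    have "y3 \<le> \<delta> / B" by (simp add: y3_def)
    then show "B \<le> \<delta> / y3" using \<open>y3 > 0\<close> B by (simp add: field_simps)
  qed
  have fy3: "f y2 < f y3"
  proof -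
    have "v y1 \<le> v y3" using y3 y2 by (intro anti) auto
    moreover have "w * y3 \<ge> 0" using wpos y3 by simp
    moreover have "f y2 - v y1 < B" by (simp add: B_def)
    ultimately show ?thesis using y3(3) unfolding f_def[of y3] by linarith
  qed
  have "continuous_on {y3..y1} f"
    unfolding f_def using y3
    by (intro continuous_intros continuous_on_subset[OF cont_v]) auto
  then obtain m where m: "m \<in> {y3..y1}" "\<And>y. y \<in> {y3..y1} \<Longrightarrow> f m \<le> f y"
    using continuous_attains_inf[of "{y3..y1}" f] y3 y2 by auto
  have "f m \<le> f y2" using y2 y3 by (intro m) auto
  then have mm: "y3 < m" "m < y1" using m(1) fy1 fy3 by (auto simp: less_le)
  have mpos: "m > 0" using mm y3 by simp
  have \<delta>m: "\<delta> / m \<le> v 0 + \<eta> * y1 - v y1"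
  proof -
    have "v y1 \<le> v m" "w * m \<ge> 0" using mm mpos wpos by (auto intro: anti)
    then show ?thesis using \<open>f m \<le> f y2\<close> fy2 unfolding f_def[of m] by linarith
  qed
  define q where "q = w - \<delta> / m\<^sup>2"
  define \<phi> where "\<phi> y = w * y + \<delta> / y" for y
  have main: "0 \<le> \<rho> * v 0 + ln w + 1 + (1 + w) * m\<^sup>2 + \<sigma>\<^sup>2 * (\<delta> / m) + 1 / 2 * \<sigma>\<^sup>2 * m\<^sup>2 * \<kappa>"
    if "\<kappa> > 0" for \<kappa>
  proof -
    have "superjet \<phi> m (w - \<delta> / m\<^sup>2) (2 * \<delta> / m ^ 3 + \<kappa>)"
    proof (rule superjet_of_C2[where \<phi>' = "\<lambda>y. w - \<delta> / y\<^sup>2"])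
      show "m > 0" by fact
      show "(\<phi> has_real_derivative w - \<delta> / y\<^sup>2) (at y)" if "\<bar>y - m\<bar> < m" for y
      proof -
        have "y \<noteq> 0" using that mpos by auto
        then show ?thesis unfolding \<phi>_def
          by (auto intro!: derivative_eq_intros simp: power2_eq_square)
      qed
      show "((\<lambda>y. w - \<delta> / y\<^sup>2) has_real_derivative 2 * \<delta> / m ^ 3) (at m)"
        using mpos by (auto intro!: derivative_eq_intros simp: field_simps eval_nat_numeral)
    qed fact
    then obtain d where d: "d > 0" "\<And>y. \<bar>y - m\<bar> < d \<Longrightarrow>
        \<phi> y \<le> \<phi> m + q * (y - m) + (2 * \<delta> / m ^ 3 + \<kappa>) / 2 * (y - m)\<^sup>2"
      unfolding q_def[symmetric] by (rule superjetE) blast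
    have j: "superjet (\<lambda>x. - v x) m q (2 * \<delta> / m ^ 3 + \<kappa>)"
    proof (rule superjetI[of "min d (min (m - y3) (y1 - m))"])
      show "0 < min d (min (m - y3) (y1 - m))" using d mm by auto
      fix y assume y: "\<bar>y - m\<bar> < min d (min (m - y3) (y1 - m))"
      then have "f m \<le> f y" by (intro m) auto
      then have "- v y \<le> - v m + \<phi> y - \<phi> m" by (simp add: f_def \<phi>_def)
      also have "\<dots> \<le> - v m + q * (y - m) + (2 * \<delta> / m ^ 3 + \<kappa>) / 2 * (y - m)\<^sup>2"
        using d(2)[of y] y by simp
      finally show "- v y \<le> - v m + q * (y - m) + (2 * \<delta> / m ^ 3 + \<kappa>) / 2 * (y - m)\<^sup>2" .
    qed
    have q: "q > 0" "- (1 / 2 * \<sigma>\<^sup>2 * m\<^sup>2 * (2 * \<delta> / m ^ 3 + \<kappa>)) \<le> \<rho> * v m + drift b m * q + ln q + m\<^sup>2 + 1"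
      using super[OF mpos j] by auto
    have "q \<le> w" using \<delta> by (simp add: q_def)
    have "drift b m \<le> m\<^sup>2" using drift_le(2)[of b m] b_pos mpos mult_pos_pos[of b m] by linarith
    then have "drift b m * q \<le> m\<^sup>2 * w" using q(1) \<open>q \<le> w\<close> by (intro mult_mono) auto
    moreover have "ln q \<le> ln w" using q(1) \<open>q \<le> w\<close> by simp
    moreover have "\<rho> * v m \<le> \<rho> * v 0" using anti[of 0 m] mpos \<rho>_pos by simp
    \<comment> \<open>The degenerate factor \<open>m\<^sup>2\<close> reduces the second derivative
      \<open>2 * \<delta> / m ^ 3\<close> to a multiple of \<open>\<delta> / m\<close>, which
      \<open>\<delta>m\<close> controls.\<close>
    moreover have "1 / 2 * \<sigma>\<^sup>2 * m\<^sup>2 * (2 * \<delta> / m ^ 3 + \<kappa>) = \<sigma>\<^sup>2 * (\<delta> / m) + 1 / 2 * \<sigma>\<^sup>2 * m\<^sup>2 * \<kappa>"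
      using mpos by (simp add: field_simps eval_nat_numeral)
    moreover have "(1 + w) * m\<^sup>2 = m\<^sup>2 + m\<^sup>2 * w" by (simp add: algebra_simps)
    ultimately show ?thesis using q(2) by linarith
  qed
  have "0 \<le> \<rho> * v 0 + ln w + 1 + (1 + w) * m\<^sup>2 + \<sigma>\<^sup>2 * (\<delta> / m) + \<epsilon>" if "\<epsilon> > 0" for \<epsilon>
  proof -
    \<comment> \<open>The added 1 keeps the denominator positive when
      \<open>\<sigma> = 0\<close>.\<close>
    define \<kappa> where "\<kappa> = \<epsilon> / (1 / 2 * \<sigma>\<^sup>2 * m\<^sup>2 + 1)"
    have pos: "1 / 2 * \<sigma>\<^sup>2 * m\<^sup>2 + 1 > 0" by (intro add_nonneg_pos) auto
    have "\<kappa> > 0" unfolding \<kappa>_def using pos that by (intro divide_pos_pos)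
    have "1 / 2 * \<sigma>\<^sup>2 * m\<^sup>2 * \<kappa> + \<kappa> = \<epsilon>"
    proof -
      have "(1 / 2 * \<sigma>\<^sup>2 * m\<^sup>2 + 1) * \<kappa> = \<epsilon>" unfolding \<kappa>_def using pos by simp
      then show ?thesis by (simp add: algebra_simps)
    qed
    then show ?thesis using main[OF \<open>\<kappa> > 0\<close>] \<open>\<kappa> > 0\<close> by linarith
  qed
  then have "0 \<le> \<rho> * v 0 + ln w + 1 + (1 + w) * m\<^sup>2 + \<sigma>\<^sup>2 * (\<delta> / m)" by (rule field_le_epsilon)
  moreover have "(1 + w) * m\<^sup>2 \<le> (1 + w) * y1\<^sup>2"
    using mm mpos wpos by (intro mult_left_mono power_mono) auto
  moreover have "\<sigma>\<^sup>2 * (\<delta> / m) \<le> \<sigma>\<^sup>2 * (v 0 + \<eta> * y1 - v y1)"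
    using \<delta>m by (intro mult_left_mono) auto
  ultimately show ?thesis by linarith
qed

text \<open>The subsolution property at \<open>0\<close> forbids superjets of slope below \<open>- exp (- 1 - \<rho> u 0)\<close>, so at
  a maximum of \<open>u - v\<close> the function \<open>v\<close> cannot be steeper than that either.\<close>

lemma boundary:
  assumes anti: "\<And>x y. 0 \<le> x \<Longrightarrow> x \<le> y \<Longrightarrow> v y \<le> v x"
    and sub0: "\<And>p. p < 0 \<Longrightarrow> (\<forall>\<^sub>F y in at 0 within {0..}. u y \<le> u 0 + p * y) \<Longrightarrow> \<rho> * u 0 + ln (- p) + 1 \<le> 0"
    and e: "e > 0" and contact: "\<And>y. 0 \<le> y \<Longrightarrow> y < e \<Longrightarrow> u y - v y \<le> u 0 - v 0 + K / 2 * y\<^sup>2"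
  shows "\<rho> * (u 0 - v 0) \<le> 0"
proof -
  define M where "M = exp (- 1 - \<rho> * u 0)"
  have M: "M > 0" by (simp add: M_def)
  have key: "0 \<le> \<rho> * v 0 + ln (M + 3 * \<eta>) + 1" if "\<eta> > 0" for \<eta>
  proof (rule field_le_epsilon)
    fix \<epsilon> :: real assume "\<epsilon> > 0"
    \<comment> \<open>A slope just beyond \<open>- M\<close> contradicts \<open>sub0\<close>, so
      \<open>u\<close> exceeds the line of slope \<open>p\<close> at points arbitrarily close to
      0.\<close>
    define p where "p = - M - \<eta>"
    have p: "p < 0" "- p > M" using M that by (auto simp: p_def)
    have "\<not> \<rho> * u 0 + ln (- p) + 1 \<le> 0"
    proof
      assume "\<rho> * u 0 + ln (- p) + 1 \<le> 0"
      then have "exp (ln (- p)) \<le> M" unfolding M_def by simp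
      then show False using p by simp
    qed
    then have "\<not> (\<forall>\<^sub>F y in at 0 within {0..}. u y \<le> u 0 + p * y)"
      using sub0[OF p(1)] by blast
    then have freq: "\<exists>\<^sub>F y in at 0 within {0..}. \<not> u y \<le> u 0 + p * y"
      by (simp add: frequently_def)
    \<comment> \<open>One \<eta> comes from \<open>p\<close>, one absorbs \<open>K / 2 * y\<close>,
      and one is the slack \<open>\<eta> * y\<close> demanded by
      \<open>supersolution_near_zero\<close>.\<close>
    define w where "w = M + 3 * \<eta>"
    have lim_v: "(v \<longlongrightarrow> v 0) (at 0 within {0..})"
      using cont_v unfolding continuous_on_def by auto
    have "((\<lambda>y. (1 + w) * y\<^sup>2 + \<sigma>\<^sup>2 * (v 0 + \<eta> * y - v y)) \<longlongrightarrow> (1 + w) * 0\<^sup>2 + \<sigma>\<^sup>2 * (v 0 + \<eta> * 0 - v 0)) (at 0 within {0..})"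
      by (intro tendsto_intros lim_v)
    then have ev1: "\<forall>\<^sub>F y in at 0 within {0..}. (1 + w) * y\<^sup>2 + \<sigma>\<^sup>2 * (v 0 + \<eta> * y - v y) < \<epsilon>"
      using \<open>\<epsilon> > 0\<close> by (intro order_tendstoD) auto
    have "((\<lambda>y. K / 2 * y) \<longlongrightarrow> K / 2 * 0) (at 0 within {0..})"
      by (intro tendsto_intros)
    then have ev2: "\<forall>\<^sub>F y in at 0 within {0..}. K / 2 * y < \<eta>"
      using that by (intro order_tendstoD) auto
    have ev3: "\<forall>\<^sub>F y in at 0 within {0..}. y < e"
      using e by (intro order_tendstoD(2)[OF tendsto_ident_at]) auto
    have ev4: "\<forall>\<^sub>F y in at 0 within {0::real..}. 0 < y"
      by (auto simp: eventually_at_filter)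
    have "\<forall>\<^sub>F y in at 0 within {0..}. (1 + w) * y\<^sup>2 + \<sigma>\<^sup>2 * (v 0 + \<eta> * y - v y) < \<epsilon> \<and> K / 2 * y < \<eta> \<and> y < e \<and> 0 < y"
      using ev1 ev2 ev3 ev4 by eventually_elim simp
    from frequently_ex[OF frequently_eventually_frequently[OF freq this]]
    obtain y where "\<not> u y \<le> u 0 + p * y" "(1 + w) * y\<^sup>2 + \<sigma>\<^sup>2 * (v 0 + \<eta> * y - v y) < \<epsilon>"
      "K / 2 * y < \<eta>" "y < e" "0 < y" by blast
    then have y: "u 0 + p * y < u y" "(1 + w) * y\<^sup>2 + \<sigma>\<^sup>2 * (v 0 + \<eta> * y - v y) < \<epsilon>"
      "K / 2 * y < \<eta>" "y < e" "0 < y" by (simp_all only: not_le)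
    have "K / 2 * y\<^sup>2 \<le> \<eta> * y"
      using mult_right_mono[of "K / 2 * y" \<eta> y] y by (simp add: power2_eq_square)
    then have "v 0 + \<eta> * y < v y + w * y"
      using contact[of y] y unfolding w_def p_def by (simp add: algebra_simps)
    from supersolution_near_zero[OF anti y(5) that _ this]
    have "0 \<le> \<rho> * v 0 + ln w + 1 + (1 + w) * y\<^sup>2 + \<sigma>\<^sup>2 * (v 0 + \<eta> * y - v y)"
      using M that by (simp add: w_def)
    then show "0 \<le> \<rho> * v 0 + ln (M + 3 * \<eta>) + 1 + \<epsilon>"
      using y(2) unfolding w_def by linarith
  qed
  \<comment> \<open>In the limit the logarithm is \<open>ln M = - 1 - \<rho> * u 0\<close>, and the
    inequality reads \<open>0 \<le> \<rho> * (v 0 - u 0)\<close>.\<close>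
  have lim: "((\<lambda>\<eta>. \<rho> * v 0 + ln (M + 3 * \<eta>) + 1) \<longlongrightarrow> \<rho> * v 0 + ln (M + 3 * 0) + 1) (at_right 0)"
    using M by (intro tendsto_intros) auto
  have "\<forall>\<^sub>F \<eta> in at_right 0. 0 \<le> \<rho> * v 0 + ln (M + 3 * \<eta>) + 1"
    using key by (auto simp: eventually_at_filter)
  from tendsto_lowerbound[OF lim this] have "0 \<le> \<rho> * v 0 + ln M + 1" by simp
  then show ?thesis by (simp add: M_def algebra_simps)
qed

end

section \<open>The penalty\<close>

definition pen :: "real \<Rightarrow> real" where
  "pen x = (1 + x\<^sup>2) * ln (1 + x\<^sup>2)"

definition pen' :: "real \<Rightarrow> real" where
  "pen' x = 2 * x * (ln (1 + x\<^sup>2) + 1)"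

definition pen'' :: "real \<Rightarrow> real" where
  "pen'' x = 2 * (ln (1 + x\<^sup>2) + 1) + 4 * x\<^sup>2 / (1 + x\<^sup>2)"

lemma one_plus_square_pos: "1 + (x::real)\<^sup>2 > 0"
  by (intro add_pos_nonneg) auto

lemma pen_nonneg: "pen x \<ge> 0" "x \<ge> 0 \<Longrightarrow> pen' x \<ge> 0"
  unfolding pen_def pen'_def by (auto intro!: mult_nonneg_nonneg add_nonneg_nonneg)

lemma DERIV_ln_one_plus_square:
  "((\<lambda>x. ln (1 + x\<^sup>2)) has_real_derivative 2 * x / (1 + x\<^sup>2)) (at x)"
  using one_plus_square_pos[of x] by (auto intro!: derivative_eq_intros)

lemma DERIV_pen: "(pen has_real_derivative pen' x) (at x)"
proof -
  have "((\<lambda>x. 1 + x\<^sup>2) has_real_derivative 2 * x) (at x)"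
    by (auto intro!: derivative_eq_intros)
  note D = DERIV_mult[OF this DERIV_ln_one_plus_square]
  have eq: "2 * x / (1 + x\<^sup>2) * (1 + x\<^sup>2) = 2 * x"
    using one_plus_square_pos[of x] by simp
  show ?thesis
    unfolding pen_def[abs_def] pen'_def
    by (rule DERIV_cong[OF D]) (simp only: eq, simp add: algebra_simps)
qed

lemma DERIV_pen': "(pen' has_real_derivative pen'' x) (at x)"
proof -
  have "((\<lambda>x. 2 * x) has_real_derivative 2) (at x)"
    by (auto intro!: derivative_eq_intros)
  from DERIV_mult[OF this DERIV_add[OF DERIV_ln_one_plus_square DERIV_const[of 1]]] show ?thesis
    unfolding pen'_def[abs_def] pen''_def by (simp add: algebra_simps power2_eq_square)
qed

lemma superjet_pen:
  assumes "\<kappa> > 0"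
  shows "superjet pen x (pen' x) (pen'' x + \<kappa>)"
  by (rule superjet_of_C2[OF zero_less_one DERIV_pen DERIV_pen' assms])

lemma ln_one_plus_square_ge:
  fixes T x :: real
  assumes "exp T \<le> x" "T \<ge> 0"
  shows "T \<le> ln (1 + x\<^sup>2)"
proof -
  have "exp T \<le> exp (2 * T)" using assms by simp
  also have "\<dots> = (exp T)\<^sup>2" by (simp add: exp_double)
  also have "\<dots> \<le> 1 + x\<^sup>2" using power_mono[OF assms(1), of 2] by simp
  finally show ?thesis using one_plus_square_pos[of x] by (simp add: ln_ge_iff)
qed

text \<open>Since \<open>pen\<close> grows like \<open>x\<^sup>2 ln x\<close>, the dominant coefficient is \<open>\<rho> + 2 b - \<sigma>\<^sup>2 > 0\<close>.\<close>

lemma pen_strict_supersolution: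
  assumes "b > 0" "\<rho> > 0" "\<sigma>\<^sup>2 < \<rho> + 2 * b" "c > 0"
  obtains C where "C \<ge> 0"
    "\<And>x. x \<ge> 0 \<Longrightarrow> drift b x * pen' x + c * pen' x + 1 / 2 * \<sigma>\<^sup>2 * x\<^sup>2 * pen'' x \<le> \<rho> * pen x + C"
proof -
  define \<gamma> where "\<gamma> = \<rho> + 2 * b - \<sigma>\<^sup>2"
  have \<gamma>: "\<gamma> > 0" using assms by (simp add: \<gamma>_def)
  define D where "D x = \<rho> * pen x - (drift b x * pen' x + c * pen' x + 1 / 2 * \<sigma>\<^sup>2 * x\<^sup>2 * pen'' x)" for x
  \<comment> \<open>Each threshold spends half of \<gamma>: \<open>T\<close> lets the logarithm
    dominate \<open>3 * \<sigma>\<^sup>2 * x\<^sup>2\<close>, and the second entry of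
    \<open>R\<close> lets \<open>x\<close> dominate the first-order terms with factor
    \<open>1 + c\<close>.\<close>
  define T where "T = max 1 (6 * \<sigma>\<^sup>2 / \<gamma>)"
  define R where "R = max (exp T) (8 * (1 + c) / \<gamma>)"
  have far: "D x \<ge> 0" if "x \<ge> R" for x
  proof -
    define s where "s = ln (1 + x\<^sup>2)"
    have "exp T \<le> x" "8 * (1 + c) / \<gamma> \<le> x" using that by (auto simp: R_def)
    then have "T \<le> s" unfolding s_def by (intro ln_one_plus_square_ge) (auto simp: T_def)
    have xpos: "x > 0" using \<open>exp T \<le> x\<close> exp_gt_zero[of T] by linarith
    have s: "s \<ge> 1" "6 * \<sigma>\<^sup>2 / \<gamma> \<le> s" using \<open>T \<le> s\<close> by (auto simp: T_def)
    have "8 * (1 + c) \<le> \<gamma> * x" using \<open>8 * (1 + c) / \<gamma> \<le> x\<close> \<gamma> by (simp add: field_simps)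
    then have "8 * (1 + c) * (x * s) \<le> \<gamma> * x * (x * s)" using xpos s by (intro mult_right_mono) auto
    then have e1: "4 * (1 + c) * (x * s) \<le> \<gamma> / 2 * (x\<^sup>2 * s)" by (simp add: power2_eq_square algebra_simps)
    have "6 * \<sigma>\<^sup>2 \<le> \<gamma> * s" using s(2) \<gamma> by (simp add: field_simps)
    then have "6 * \<sigma>\<^sup>2 * x\<^sup>2 \<le> \<gamma> * s * x\<^sup>2" by (intro mult_right_mono) auto
    then have e2: "3 * \<sigma>\<^sup>2 * x\<^sup>2 \<le> \<gamma> / 2 * (x\<^sup>2 * s)" by (simp add: algebra_simps)
    have "x * (s + 1) \<le> x * (2 * s)" using xpos s by (intro mult_left_mono) auto
    then have e3: "2 * (1 + c) * (x * (s + 1)) \<le> 4 * (1 + c) * (x * s)"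
    proof -
      have "2 * (1 + c) * (x * (s + 1)) \<le> 2 * (1 + c) * (x * (2 * s))"
        by (rule mult_left_mono[OF \<open>x * (s + 1) \<le> x * (2 * s)\<close>]) (use assms in auto)
      then show ?thesis by (simp add: algebra_simps)
    qed
    have "(drift b x + c) * pen' x \<le> (1 - b * x + c) * pen' x"
      using drift_le(1)[of b x] pen_nonneg(2)[of x] xpos by (intro mult_right_mono) auto
    then have e4: "(drift b x + c) * pen' x \<le> 2 * (1 + c) * (x * (s + 1)) - 2 * b * (x\<^sup>2 * s) - 2 * b * x\<^sup>2"
      unfolding pen'_def s_def[symmetric] by (simp add: algebra_simps power2_eq_square)
    have e5: "\<rho> * (x\<^sup>2 * s) \<le> \<rho> * pen x"
      unfolding pen_def s_def[symmetric] using assms s by (intro mult_left_mono mult_right_mono) auto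
    have "4 * x\<^sup>2 / (1 + x\<^sup>2) \<le> 4" using one_plus_square_pos[of x] by (simp add: divide_simps)
    then have "pen'' x \<le> 2 * (s + 1) + 4" unfolding pen''_def s_def by simp
    then have "1 / 2 * \<sigma>\<^sup>2 * x\<^sup>2 * pen'' x \<le> 1 / 2 * \<sigma>\<^sup>2 * x\<^sup>2 * (2 * (s + 1) + 4)"
      by (intro mult_left_mono) auto
    also have "\<dots> = \<sigma>\<^sup>2 * (x\<^sup>2 * s) + 3 * \<sigma>\<^sup>2 * x\<^sup>2" by (simp add: algebra_simps)
    finally have e6: "1 / 2 * \<sigma>\<^sup>2 * x\<^sup>2 * pen'' x \<le> \<sigma>\<^sup>2 * (x\<^sup>2 * s) + 3 * \<sigma>\<^sup>2 * x\<^sup>2" .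
    have "b * x\<^sup>2 \<ge> 0" using assms by simp
    moreover have "\<gamma> * (x\<^sup>2 * s) = \<rho> * (x\<^sup>2 * s) + 2 * b * (x\<^sup>2 * s) - \<sigma>\<^sup>2 * (x\<^sup>2 * s)"
      by (simp add: \<gamma>_def algebra_simps)
    ultimately show ?thesis
      using e1 e2 e3 e4 e5 e6 unfolding D_def by (simp add: distrib_right)
  qed
  \<comment> \<open>On the remaining compact interval \<open>D\<close> is merely bounded; this bound
    is \<open>C\<close>.\<close>
  have "continuous_on {0..R} D"
    unfolding D_def pen''_def
    by (intro continuous_intros continuous_at_imp_continuous_on ballI continuous_drift
        DERIV_isCont[OF DERIV_pen] DERIV_isCont[OF DERIV_pen'])
      (use one_plus_square_pos in \<open>auto simp: less_imp_neq[symmetric]\<close>)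
  then obtain C where C: "C \<ge> 0" "\<And>x. 0 \<le> x \<Longrightarrow> x \<le> R \<Longrightarrow> \<bar>D x\<bar> \<le> C"
    by (rule continuous_on_Icc_bounded) blast
  show thesis
  proof (rule that[OF C(1)])
    fix x :: real assume "x \<ge> 0"
    then have "D x \<ge> - C" using far[of x] C(2)[of x] C(1) by (cases "x \<ge> R") auto
    then show "drift b x * pen' x + c * pen' x + 1 / 2 * \<sigma>\<^sup>2 * x\<^sup>2 * pen'' x \<le> \<rho> * pen x + C"
      by (simp add: D_def)
  qed
qed

text \<open>Beyond \<open>exp T\<close> the factor
  \<open>B - \<epsilon> * ln (1 + x\<^sup>2)\<close> is so negative that the penalized difference is
  at most its value at 0; a maximum over the compact rest is global.\<close>

lemma penalized_attains_sup:
  fixes u v :: "real \<Rightarrow> real"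
  assumes cont: "continuous_on {0..} u" "continuous_on {0..} v"
    and upper: "\<And>x. x \<ge> 0 \<Longrightarrow> u x - v x \<le> A + B * (1 + x\<^sup>2)" and "\<epsilon> > 0"
  obtains x0 where "x0 \<ge> 0" "\<And>x. x \<ge> 0 \<Longrightarrow> u x - v x - \<epsilon> * pen x \<le> u x0 - v x0 - \<epsilon> * pen x0"
proof -
  define W where "W x = u x - v x - \<epsilon> * pen x" for x
  define T where "T = (\<bar>A\<bar> + \<bar>W 0\<bar> + \<bar>B\<bar>) / \<epsilon>"
  have T: "T \<ge> 0" "\<epsilon> * T = \<bar>A\<bar> + \<bar>W 0\<bar> + \<bar>B\<bar>" using \<open>\<epsilon> > 0\<close> by (simp_all add: T_def)
  have far: "W x \<le> W 0" if "x \<ge> exp T" for x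
  proof -
    have "x \<ge> 0" using that exp_ge_zero[of T] by linarith
    have "\<epsilon> * T \<le> \<epsilon> * ln (1 + x\<^sup>2)"
      using ln_one_plus_square_ge[OF that T(1)] \<open>\<epsilon> > 0\<close> by simp
    then have "B - \<epsilon> * ln (1 + x\<^sup>2) \<le> - (\<bar>A\<bar> + \<bar>W 0\<bar>)" using T(2) by linarith
    then have "(1 + x\<^sup>2) * (B - \<epsilon> * ln (1 + x\<^sup>2)) \<le> (1 + x\<^sup>2) * - (\<bar>A\<bar> + \<bar>W 0\<bar>)"
      using one_plus_square_pos[of x] by (intro mult_left_mono) auto
    also have "\<dots> \<le> 1 * - (\<bar>A\<bar> + \<bar>W 0\<bar>)" by (intro mult_right_mono_neg) auto
    finally have "A + B * (1 + x\<^sup>2) - \<epsilon> * pen x \<le> W 0" unfolding pen_def by (simp add: algebra_simps)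
    then show ?thesis using upper[OF \<open>x \<ge> 0\<close>] unfolding W_def[of x] by linarith
  qed
  have "continuous_on {0..exp T} W"
    unfolding W_def
    by (intro continuous_intros continuous_on_subset[OF cont(1)] continuous_on_subset[OF cont(2)]
        continuous_at_imp_continuous_on ballI DERIV_isCont[OF DERIV_pen]) auto
  then obtain x0 where x0: "x0 \<in> {0..exp T}" "\<And>x. x \<in> {0..exp T} \<Longrightarrow> W x \<le> W x0"
    using continuous_attains_sup[of "{0..exp T}" W] by auto
  have "W x \<le> W x0" if "x \<ge> 0" for x
    using far[of x] x0(2)[of x] x0(2)[of 0] that by (cases "x \<ge> exp T") auto
  then show thesis using that x0(1) unfolding W_def by auto
qed

section \<open>The comparison argument on the half-line\<close>

theorem theorem2p2:
  fixes b \<rho> \<sigma> c cstar :: real and u v :: "real \<Rightarrow> real"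
  assumes "b > 0" and "\<rho> > 0" and "\<sigma> \<ge> 0" and "\<sigma>\<^sup>2 < \<rho> + 2 * b"
    and "continuous_on {0..} u" and "bdd_above (u ` {0..})" and "strict_antimono_on {0..} u"
    and "viscosity_subsolution_on b \<rho> \<sigma> {0..} u"
    and "continuous_on {0..} v" and "bdd_above (v ` {0..})" and "strict_antimono_on {0..} v"
    and "viscosity_supersolution_on b \<rho> \<sigma> {0<..} v"
    and "c > 0" and "cstar > 0"
    and "\<And>x. x \<ge> 0 \<Longrightarrow> v x \<ge> - c * (1 + x\<^sup>2)"
    and "viscosity_deriv_le_on {0<..} u (- 1 / cstar)"
  shows "\<forall>x\<ge>0. u x \<le> v x"
proof -
  interpret lake_pair b \<rho> \<sigma> cstar u v
  proof
    fix x p X :: real assume x: "x > 0"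
    show "p \<le> - 1 / cstar \<and> \<rho> * u x - drift b x * p + ln (- p) + x\<^sup>2 + 1 \<le> 1 / 2 * \<sigma>\<^sup>2 * x\<^sup>2 * X"
      if j: "superjet u x p X"
    proof -
      have p: "p \<le> - 1 / cstar" by (rule deriv_le_jet[OF assms(16) _ j]) (use x in auto)
      also have "\<dots> < 0" using \<open>cstar > 0\<close> by simp
      finally have "p < 0" .
      have "\<forall>\<^sub>F y in at x within {0..}. u y \<le> u x + p * (y - x) + X / 2 * (y - x)\<^sup>2"
        using filter_leD[OF at_le[OF subset_UNIV] j[unfolded superjet_def]] .
      from subsolution_jet[OF assms(8) _ \<open>p < 0\<close> this]
      have "\<rho> * u x - drift b x * p + ln (- p) + x\<^sup>2 + 1 \<le> 1 / 2 * \<sigma>\<^sup>2 * x\<^sup>2 * X"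
        using x by simp
      then show ?thesis using p by blast
    qed
    show "p > 0 \<and> - (1 / 2 * \<sigma>\<^sup>2 * x\<^sup>2 * X) \<le> \<rho> * v x + drift b x * p + ln p + x\<^sup>2 + 1"
      if j: "superjet (\<lambda>x. - v x) x p X"
      using supersolution_jet[OF assms(12) _ j] x by simp
  qed (fact assms)+
  obtain Cu where Cu: "\<And>x. x \<ge> 0 \<Longrightarrow> u x \<le> Cu"
    using assms(6) unfolding bdd_above_def by auto
  have upper: "u x - v x \<le> Cu + c * (1 + x\<^sup>2)" if "x \<ge> 0" for x
    using Cu[OF that] assms(15)[OF that] by simp
  have anti: "v y \<le> v x" if "0 \<le> x" "x \<le> y" for x y
    using assms(11) that unfolding monotone_on_def by (cases "x = y") (auto simp: less_imp_le)
  have sub0: "\<rho> * u 0 + ln (- p) + 1 \<le> 0"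
    if "p < 0" "\<forall>\<^sub>F y in at 0 within {0..}. u y \<le> u 0 + p * y" for p
    using subsolution_jet[OF assms(8) _ that(1), of 0 0] that(2) by (simp add: drift_def)
  obtain C where C: "C \<ge> 0"
    "\<And>x. x \<ge> 0 \<Longrightarrow> drift b x * pen' x + cstar * pen' x + 1 / 2 * \<sigma>\<^sup>2 * x\<^sup>2 * pen'' x \<le> \<rho> * pen x + C"
    using pen_strict_supersolution[OF assms(1,2,4,14)] by blast
  show ?thesis
  proof (intro allI impI, rule ccontr)
    fix z :: real assume z: "z \<ge> 0" "\<not> u z \<le> v z"
    \<comment> \<open>Half of \<open>u z - v z\<close> pays for the penalty at \<open>z\<close> and
      for \<open>C / \<rho>\<close>, so the penalized maximum exceeds
      \<open>\<epsilon> * (C / \<rho>)\<close>, the loss caused by the constant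
      \<open>C\<close>.\<close>
    define \<epsilon> where "\<epsilon> = (u z - v z) / 2 / (pen z + C / \<rho> + 1)"
    have den: "pen z + C / \<rho> + 1 > 0" using pen_nonneg(1)[of z] C(1) \<open>\<rho> > 0\<close> by (intro add_nonneg_pos) auto
    have \<epsilon>: "\<epsilon> > 0" using z den by (simp add: \<epsilon>_def)
    have "\<epsilon> * (pen z + C / \<rho> + 1) = (u z - v z) / 2"
      using den unfolding \<epsilon>_def by (metis less_irrefl nonzero_eq_divide_eq)
    then have "\<epsilon> * pen z + \<epsilon> * (C / \<rho>) + \<epsilon> = (u z - v z) / 2" by (simp add: algebra_simps)
    then have uvz: "\<epsilon> * (C / \<rho>) < u z - v z - \<epsilon> * pen z" using \<epsilon> z by argo
    obtain x0 where x0: "x0 \<ge> 0" "\<And>x. x \<ge> 0 \<Longrightarrow> u x - v x - \<epsilon> * pen x \<le> u x0 - v x0 - \<epsilon> * pen x0"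
      using penalized_attains_sup[OF assms(5,9) upper \<epsilon>] by blast
    have big: "\<epsilon> * (C / \<rho>) < u x0 - v x0 - \<epsilon> * pen x0" using uvz x0(2)[OF z(1)] by linarith
    have touch: "\<exists>d>0. \<forall>x. 0 \<le> x \<longrightarrow> \<bar>x - x0\<bar> < d \<longrightarrow>
        u x - v x \<le> u x0 - v x0 + \<epsilon> * pen' x0 * (x - x0) + \<epsilon> * (pen'' x0 + \<kappa>) / 2 * (x - x0)\<^sup>2"
      if \<kappa>: "\<kappa> > 0" for \<kappa>
    proof -
      obtain d where d: "d > 0" "\<And>x. \<bar>x - x0\<bar> < d \<Longrightarrow>
          pen x \<le> pen x0 + pen' x0 * (x - x0) + (pen'' x0 + \<kappa>) / 2 * (x - x0)\<^sup>2"
        using superjetE[OF superjet_pen[OF \<kappa>]] by blast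
      have "u x - v x \<le> u x0 - v x0 + \<epsilon> * pen' x0 * (x - x0) + \<epsilon> * (pen'' x0 + \<kappa>) / 2 * (x - x0)\<^sup>2"
        if "0 \<le> x" "\<bar>x - x0\<bar> < d" for x
      proof -
        have "\<epsilon> * pen x \<le> \<epsilon> * (pen x0 + pen' x0 * (x - x0) + (pen'' x0 + \<kappa>) / 2 * (x - x0)\<^sup>2)"
          using d(2)[OF that(2)] \<epsilon> by simp
        also have "\<dots> = \<epsilon> * pen x0 + \<epsilon> * pen' x0 * (x - x0) + \<epsilon> * (pen'' x0 + \<kappa>) / 2 * (x - x0)\<^sup>2"
          by (simp add: algebra_simps)
        finally show ?thesis using x0(2)[OF that(1)] by linarith
      qed
      then show ?thesis using d(1) by blast
    qed
    show False
    proof (cases "x0 = 0")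
      case True
      obtain d where d: "d > 0" "\<And>x. 0 \<le> x \<Longrightarrow> \<bar>x - x0\<bar> < d \<Longrightarrow>
        u x - v x \<le> u x0 - v x0 + \<epsilon> * pen' x0 * (x - x0) + \<epsilon> * (pen'' x0 + 1) / 2 * (x - x0)\<^sup>2"
        using touch[OF zero_less_one] by blast
      \<comment> \<open>As \<open>pen'\<close> vanishes at 0, the contact bound has no linear term,
        as \<open>boundary\<close> requires.\<close>
      have "\<rho> * (u 0 - v 0) \<le> 0"
        by (rule boundary[OF anti sub0 d(1), of "\<epsilon> * (pen'' x0 + 1)"]) (use d(2) True in \<open>auto simp: pen'_def\<close>)
      then have "u 0 - v 0 \<le> 0" using \<open>\<rho> > 0\<close> by (simp add: mult_le_0_iff)
      moreover have "\<epsilon> * (C / \<rho>) \<ge> 0" "\<epsilon> * pen x0 \<ge> 0" using \<epsilon> C(1) \<open>\<rho> > 0\<close> pen_nonneg(1) by auto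
      ultimately show False using big True by simp
    next
      case False
      then have xpos: "x0 > 0" using x0 by simp
      have le: "\<rho> * (u x0 - v x0) \<le> drift b x0 * (\<epsilon> * pen' x0) + cstar * \<bar>\<epsilon> * pen' x0\<bar>
          + 1 / 2 * \<sigma>\<^sup>2 * x0\<^sup>2 * (\<epsilon> * (pen'' x0 + \<kappa>))" if \<kappa>: "\<kappa> > 0" for \<kappa>
      proof (rule interior[OF xpos])
        obtain d where d: "d > 0" "\<And>x. 0 \<le> x \<Longrightarrow> \<bar>x - x0\<bar> < d \<Longrightarrow>
          u x - v x \<le> u x0 - v x0 + \<epsilon> * pen' x0 * (x - x0) + \<epsilon> * (pen'' x0 + \<kappa>) / 2 * (x - x0)\<^sup>2"
          using touch[OF \<kappa>] by blast
        show "superjet (\<lambda>x. u x - v x) x0 (\<epsilon> * pen' x0) (\<epsilon> * (pen'' x0 + \<kappa>))"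
          by (rule superjetI[of "min d x0"]) (use d xpos in auto)
      qed
      \<comment> \<open>The margin \<kappa> from the superjets of \<open>pen\<close> is removed in
        the limit, before the estimate for the penalty is applied.\<close>
      have lim: "((\<lambda>\<kappa>. drift b x0 * (\<epsilon> * pen' x0) + cstar * \<bar>\<epsilon> * pen' x0\<bar>
          + 1 / 2 * \<sigma>\<^sup>2 * x0\<^sup>2 * (\<epsilon> * (pen'' x0 + \<kappa>))) \<longlongrightarrow> drift b x0 * (\<epsilon> * pen' x0) + cstar * \<bar>\<epsilon> * pen' x0\<bar>
          + 1 / 2 * \<sigma>\<^sup>2 * x0\<^sup>2 * (\<epsilon> * (pen'' x0 + 0))) (at_right 0)"
        by (intro tendsto_intros)
      have "\<rho> * (u x0 - v x0) \<le> drift b x0 * (\<epsilon> * pen' x0) + cstar * \<bar>\<epsilon> * pen' x0\<bar>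
          + 1 / 2 * \<sigma>\<^sup>2 * x0\<^sup>2 * (\<epsilon> * (pen'' x0 + 0))"
        by (rule tendsto_lowerbound[OF lim]) (use le in \<open>auto simp: eventually_at_filter\<close>)
      also have "\<bar>\<epsilon> * pen' x0\<bar> = \<epsilon> * pen' x0" using \<epsilon> pen_nonneg(2)[OF x0(1)] by simp
      also have "drift b x0 * (\<epsilon> * pen' x0) + cstar * (\<epsilon> * pen' x0) + 1 / 2 * \<sigma>\<^sup>2 * x0\<^sup>2 * (\<epsilon> * (pen'' x0 + 0))
          = \<epsilon> * (drift b x0 * pen' x0 + cstar * pen' x0 + 1 / 2 * \<sigma>\<^sup>2 * x0\<^sup>2 * pen'' x0)"
        by (simp add: algebra_simps)
      also have "\<dots> \<le> \<epsilon> * (\<rho> * pen x0 + C)" using C(2)[OF x0(1)] \<epsilon> by simp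
      also have "\<dots> = \<rho> * (\<epsilon> * pen x0 + \<epsilon> * (C / \<rho>))" using \<open>\<rho> > 0\<close> by (simp add: algebra_simps)
      finally show False using big \<open>\<rho> > 0\<close> by simp
    qed
  qed
qed

end
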